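(* (a) Let $X$ be a real Banach space and let $A\subset X$ be a relatively super weakly compact set. Then every sequence $(x_n)\subset A$ contains a uniformly weakly convergent subsequence. (b) This property does not characterize relative super weak compactness: there exist a Banach space $X$ and a set $A\subset X$ such that every sequence in $A$ contains a uniformly weakly convergent subsequence, but $A$ is not relatively super weakly compact. (c) The property characterizes the Banach-Saks property: for a subset $A$ of a Banach space $X$, every sequence in $A$ contains a uniformly weakly convergent subsequence if and only if $A$ has the Banach-Saks property.
   Context: A set $A\subset X$ is uniformly weakly null if for every $\varepsilon>0$ there is $n(\varepsilon)\in\mathbb{N}$ such that $|\{x\in A:|x^*(x)|>\varepsilon\}|\le n(\varepsilon)$ for every $x^*\in B_{X^*}$, where $|S|$ denotes the cardinality of $S$. A sequence $(x_n)$ is uniformly weakly null if the set $\{x_n:n\in\mathbb{N}\}$ is uniformly weakly null, and it is uniformly weakly convergent (to $x\in X$) if $(x_n-x)$ is a uniformly weakly null sequence for some $x \in X$. A sequence $(x_n)$ is Cesàro convergent if its arithmetic means $n^{-1}\sum_{k=1}^n x_k$ converge in norm to some $x\in X$. A set $A\subset X$ has the Banach-Saks property if every sequence in $A$ has a Cesàro convergent subsequence. For a free ultrafilter $\mathcal U$ on $\mathbb{N}$, $X^{\mathcal U}$ is the quotient of $\ell_\infty(X)$ by the subspace of those $(x_n)$ with $\lim_{n,\mathcal U}\|x_n\|=0$, and for a bounded set $A\subset X$, $A^{\mathcal U}\subset X^{\mathcal U}$ is the set of elements having a representative in $A^{\mathbb N}$. A bounded set $A\subset X$ is relatively super weakly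 compact if $A^{\mathcal U}$ is a relatively weakly compact subset of $X^{\mathcal U}$ for some (equivalently, any) free ultrafilter $\mathcal U$ on $\mathbb{N}$. *)

theory Defs
  imports "HOL-Analysis.Analysis"
begin

section \<open>Uniformly weakly convergent sequences and the Banach-Saks property\<close>

definition uniformly_weakly_null_set :: "'a::real_normed_vector set \<Rightarrow> bool" where
  "uniformly_weakly_null_set A \<longleftrightarrow>
     (\<forall>\<epsilon>>0. \<exists>n::nat. \<forall>f :: 'a \<Rightarrow>\<^sub>L real. norm f \<le> 1 \<longrightarrow>
        finite {x \<in> A. \<bar>blinfun_apply f x\<bar> > \<epsilon>} \<and> card {x \<in> A. \<bar>blinfun_apply f x\<bar> > \<epsilon>} \<le> n)"

(* Deliberately a condition on the range only, so repetitions are not counted: every sequence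
   with finite range qualifies. *)
definition uniformly_weakly_null :: "(nat \<Rightarrow> 'a::real_normed_vector) \<Rightarrow> bool" where
  "uniformly_weakly_null x \<longleftrightarrow> uniformly_weakly_null_set (range x)"

definition uniformly_weakly_convergent :: "(nat \<Rightarrow> 'a::real_normed_vector) \<Rightarrow> bool" where
  "uniformly_weakly_convergent x \<longleftrightarrow> (\<exists>l. uniformly_weakly_null (\<lambda>n. x n - l))"

(* Sequences are indexed from 0; the means are (x 0 + ... + x (n - 1)) / n. *)
definition Cesaro_convergent :: "(nat \<Rightarrow> 'a::real_normed_vector) \<Rightarrow> bool" where
  "Cesaro_convergent x \<longleftrightarrow> convergent (\<lambda>n. (\<Sum>k<n. x k) /\<^sub>R real n)"

definition Banach_Saks_set :: "'a::real_normed_vector set \<Rightarrow> bool" where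
  "Banach_Saks_set A \<longleftrightarrow>
     (\<forall>x :: nat \<Rightarrow> 'a. range x \<subseteq> A \<longrightarrow> (\<exists>r. strict_mono r \<and> Cesaro_convergent (x \<circ> r)))"


section \<open>Quotient spaces and their weak topology\<close>

text \<open>
  The ultrapower depends on an ultrafilter, so it cannot be a type. Quotients of a normed
  space by a linear subspace \<open>N\<close> are therefore sets of cosets. All operations are well defined
  on cosets as soon as \<open>N\<close> is a subspace, and the quotient seminorm is a norm when \<open>N\<close> is closed.
\<close>

definition coset :: "'b::real_normed_vector set \<Rightarrow> 'b \<Rightarrow> 'b set" where
  "coset N x = (\<lambda>y. x + y) ` N"

definition quotient_space :: "'b::real_normed_vector set \<Rightarrow> 'b set set" where
  "quotient_space N = range (coset N)"

definition quotient_norm :: "'b::real_normed_vector set \<Rightarrow> real" where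
  "quotient_norm C = (INF y\<in>C. norm y)"

(* Only the values of a functional on cosets of N matter; it is arbitrary elsewhere. *)
definition quotient_dual :: "'b::real_normed_vector set \<Rightarrow> ('b set \<Rightarrow> real) set" where
  "quotient_dual N = {\<phi>.
     (\<forall>x y. \<phi> (coset N (x + y)) = \<phi> (coset N x) + \<phi> (coset N y)) \<and>
     (\<forall>c x. \<phi> (coset N (c *\<^sub>R x)) = c * \<phi> (coset N x)) \<and>
     (\<exists>K. \<forall>C\<in>quotient_space N. \<bar>\<phi> C\<bar> \<le> K * quotient_norm C)}"

definition quotient_weak_topology :: "'b::real_normed_vector set \<Rightarrow> 'b set topology" where
  "quotient_weak_topology N =
     topology_generated_by {{C \<in> quotient_space N. \<phi> C \<in> W} | \<phi> W. \<phi> \<in> quotient_dual N \<and> open W}"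

lemma topspace_quotient_weak_topology [simp]:
  "topspace (quotient_weak_topology N) = quotient_space N"
proof -
  have "(\<lambda>_. 0) \<in> quotient_dual N"
    by (auto simp: quotient_dual_def intro: exI[of _ 0])
  then have "quotient_space N \<in>
      {{C \<in> quotient_space N. \<phi> C \<in> W} | \<phi> W. \<phi> \<in> quotient_dual N \<and> open W}"
    by (intro CollectI exI[of _ "\<lambda>_. 0"] exI[of _ UNIV]) auto
  then show ?thesis
    unfolding quotient_weak_topology_def topology_generated_by_topspace by blast
qed


section \<open>Ultrapowers and relative super weak compactness\<close>

definition free_ultrafilter :: "nat filter \<Rightarrow> bool" where
  "free_ultrafilter \<U> \<longleftrightarrow>
     \<U> \<noteq> bot \<and>
     (\<forall>P. eventually P \<U> \<or> eventually (\<lambda>n. \<not> P n) \<U>) \<and>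
     (\<forall>m. eventually (\<lambda>n. n \<noteq> m) \<U>)"

text \<open>
  As \<open>nat\<close> is discrete, \<open>nat \<Rightarrow>\<^sub>C 'a\<close> is the space of all bounded sequences with the supremum
  norm. The ultrapower is \<open>quotient_space (ultra_null_sequences \<U>)\<close>.
\<close>

definition ultra_null_sequences :: "nat filter \<Rightarrow> (nat \<Rightarrow>\<^sub>C 'a::real_normed_vector) set" where
  "ultra_null_sequences \<U> = {x. ((\<lambda>n. norm (apply_bcontfun x n)) \<longlongrightarrow> 0) \<U>}"

definition ultrapower_set ::
    "nat filter \<Rightarrow> 'a::real_normed_vector set \<Rightarrow> (nat \<Rightarrow>\<^sub>C 'a) set set" where
  "ultrapower_set \<U> A = {coset (ultra_null_sequences \<U>) x | x. \<forall>n. apply_bcontfun x n \<in> A}"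

definition relatively_super_weakly_compact :: "'a::real_normed_vector set \<Rightarrow> bool" where
  "relatively_super_weakly_compact A \<longleftrightarrow>
     bounded A \<and>
     (\<exists>\<U>. free_ultrafilter \<U> \<and>
        (let T = quotient_weak_topology (ultra_null_sequences \<U>)
         in compactin T (T closure_of ultrapower_set \<U> A)))"

end

theory Submission
  imports Defs "HOL-Library.Ramsey" "HOL-Library.Diagonal_Subsequence"
begin

text \<open>
  Part (c). In an injective uniformly weakly null sequence every functional of norm at most 1 is
  small outside boundedly many terms, so the norms of the means tend to 0. Conversely, in a
  Banach-Saks set a diagonal argument over countably many norming functionals gives a subsequence
  all of whose Cesaro convergent subsequences have the same limit \<open>l\<close>. If the terms minus \<open>l\<close> had no
  uniformly weakly null subsequence, Ramsey's theorem and another diagonal argument would give a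
  subsequence for which, for every \<open>n\<close>, any \<open>n\<close> terms beyond the \<open>n\<close>-th one are jointly larger than
  some \<open>\<epsilon>\<close> under a single functional; comparing the means at \<open>n\<close> and \<open>2 * n\<close> shows that no
  subsequence of it has means tending to \<open>l\<close>.

  Part (a). By Grothendieck's double limit argument in the ultrapower, relative super weak
  compactness bounds the length of ladders, that is, finite sequences in \<open>A\<close> each of whose initial
  segments is separated from the remaining terms, with a fixed gap, by a functional of norm at most 1.
  By Ramsey's theorem every sequence then has a subsequence in which no functional separates the
  first half from the second half of any \<open>2 * k\<close> terms. So any two disjoint long blocks of equal
  length have nearly equal averages, which makes the means Cauchy; conclude by part (c).

  Part (b). Disjoint copies of the first \<open>N\<close> members of the summing basis of \<open>c\<^sub>0\<close>, for all \<open>N\<close>, form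
  a set that contains ladders of every length. A sequence in this set either has finite range or
  has a subsequence of disjointly supported vectors, which is uniformly weakly null.
\<close>

section \<open>Hahn-Banach functionals for one vector and for finite sets of vectors\<close>

section \<open>Norming functionals\<close>

text \<open>This is Hahn-Banach with the norm as dominating function: Zorn's lemma gives a maximal
  admissible graph, and the one-dimensional extension step shows that its domain is the whole
  space.\<close>

lemma norming_functional:
  fixes x :: "'a::real_normed_vector"
  obtains f :: "'a \<Rightarrow>\<^sub>L real" where "norm f \<le> 1" "f x = norm x"
proof -
  text \<open>Partial functionals are encoded as graphs; the bound \<open>a \<le> norm v\<close> makes them single-valued.\<close>
  define \<A> where "\<A> = {G :: ('a \<times> real) set.
    subspace G \<and> (x, norm x) \<in> G \<and> (\<forall>(v, a)\<in>G. a \<le> norm v)}"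
  have "span {(x, norm x)} \<in> \<A>"
  proof -
    have "a \<le> norm v" if "(v, a) \<in> span {(x, norm x)}" for v a
      using that by (auto simp: span_singleton mult_right_mono)
    then show ?thesis
      by (auto simp: \<A>_def span_base)
  qed
  moreover have "\<Union>\<C> \<in> \<A>" if "\<C> \<noteq> {}" and ch: "subset.chain \<A> \<C>" for \<C>
  proof -
    have "\<C> \<subseteq> \<A>" and total: "\<And>G H. G \<in> \<C> \<Longrightarrow> H \<in> \<C> \<Longrightarrow> G \<subseteq> H \<or> H \<subseteq> G"
      using ch by (auto simp: subset_chain_def)
    then have sub: "\<And>G. G \<in> \<C> \<Longrightarrow> subspace G"
      and mem: "\<And>G. G \<in> \<C> \<Longrightarrow> (x, norm x) \<in> G"
      and bnd: "\<And>G v a. G \<in> \<C> \<Longrightarrow> (v, a) \<in> G \<Longrightarrow> a \<le> norm v"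
      unfolding \<A>_def by blast+
    have "subspace (\<Union>\<C>)"
    proof (rule subspaceI)
      show "0 \<in> \<Union>\<C>"
        using \<open>\<C> \<noteq> {}\<close> sub subspace_0 by blast
      show "p + q \<in> \<Union>\<C>" if pq: "p \<in> \<Union>\<C>" "q \<in> \<Union>\<C>" for p q
      proof -
        obtain G H where "G \<in> \<C>" "H \<in> \<C>" "p \<in> G" "q \<in> H"
          using pq by blast
        then obtain K where "K \<in> \<C>" "p \<in> K" "q \<in> K"
          using total by blast
        then show ?thesis
          using sub subspace_add by blast
      qed
      show "c *\<^sub>R p \<in> \<Union>\<C>" if p: "p \<in> \<Union>\<C>" for c p
        using p sub subspace_scale by blast
    qed
    moreover have "(x, norm x) \<in> \<Union>\<C>"
      using \<open>\<C> \<noteq> {}\<close> mem by blast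
    ultimately show ?thesis
      using bnd unfolding \<A>_def by blast
  qed
  ultimately obtain M where "M \<in> \<A>" and max: "\<And>G. G \<in> \<A> \<Longrightarrow> M \<subseteq> G \<Longrightarrow> G = M"
    using subset_Zorn_nonempty[of \<A>] by blast
  then have sM: "subspace M" and xM: "(x, norm x) \<in> M"
    and le: "\<And>v a. (v, a) \<in> M \<Longrightarrow> a \<le> norm v"
    unfolding \<A>_def by blast+
  have total: "\<exists>a. (v, a) \<in> M" for v
  proof -
    \<comment> \<open>\<open>S\<close> consists of the lower bounds that \<open>M\<close> imposes on
      the value of an extension at \<open>v\<close>. By \<open>up\<close> each of them lies below
      every upper bound \<open>norm (u' + v) - a'\<close>, so \<open>Sup S\<close> is an admissible
      value.\<close>
    define S where "S = (\<lambda>(u, a). a - norm (u - v)) ` M"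
    have up: "a - norm (u - v) \<le> norm (u' + v) - a'" if "(u, a) \<in> M" "(u', a') \<in> M" for u a u' a'
    proof -
      have "a + a' \<le> norm (u + u')"
        using le subspace_add[OF sM that] by simp
      also have "\<dots> \<le> norm (u - v) + norm (u' + v)"
        using norm_triangle_ineq[of "u - v" "u' + v"] by simp
      finally show ?thesis by simp
    qed
    have "S \<noteq> {}"
      using xM by (auto simp: S_def)
    have "bdd_above S"
      unfolding S_def
      by (rule bdd_aboveI2[where M = "norm (x + v) - norm x"]) (use up[OF _ xM] in auto)
    define c where "c = Sup S"
    have lo: "a - norm (u - v) \<le> c" if "(u, a) \<in> M" for u a
      unfolding c_def using that \<open>bdd_above S\<close> by (intro cSup_upper) (force simp: S_def)
    have hi: "c \<le> norm (u + v) - a" if "(u, a) \<in> M" for u a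
      unfolding c_def using \<open>S \<noteq> {}\<close> up that by (intro cSup_least) (auto simp: S_def)
    define G where "G = span (insert (v, c) M)"
    have "b \<le> norm w" if wb: "(w, b) \<in> G" for w b
    proof -
      obtain k where k: "(w - k *\<^sub>R v, b - k * c) \<in> M"
        using wb by (auto simp: G_def span_insert span_eq_iff[THEN iffD2, OF sM])
      \<comment> \<open>For nonzero \<open>k\<close>, division by \<open>\<bar>k\<bar>\<close> makes
        the coefficient of \<open>v\<close> equal to 1 or -1, which is the situation of
        \<open>hi\<close> and \<open>lo\<close>.\<close>
      consider "k = 0" | "k > 0" | "k < 0"
        by linarith
      then show ?thesis
      proof cases
        case 1
        then show ?thesis using k le by simp
      next
        case 2
        have "((1 / k) *\<^sub>R (w - k *\<^sub>R v), (b - k * c) / k) \<in> M"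
          using subspace_scale[OF sM k, of "1 / k"] by simp
        from hi[OF this] have "c \<le> norm ((1 / k) *\<^sub>R w) - (b - k * c) / k"
          using 2 by (simp add: algebra_simps)
        then show ?thesis using 2 by (simp add: field_simps)
      next
        case 3
        have "((1 / - k) *\<^sub>R (w - k *\<^sub>R v), (b - k * c) / - k) \<in> M"
          using subspace_scale[OF sM k, of "1 / - k"] by simp
        from lo[OF this] have "(b - k * c) / - k - norm ((1 / k) *\<^sub>R w) \<le> c"
          using 3 by (simp add: algebra_simps)
        then show ?thesis using 3 by (simp add: field_simps)
      qed
    qed
    moreover have "M \<subseteq> G" "(v, c) \<in> G"
      by (auto simp: G_def span_base)
    ultimately have "G \<in> \<A>"
      using xM by (auto simp: \<A>_def G_def)
    with max \<open>M \<subseteq> G\<close> \<open>(v, c) \<in> G\<close> show ?thesis by blast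
  qed
  have uniq: "a = b" if "(v, a) \<in> M" "(v, b) \<in> M" for v a b
    using le[of 0 "a - b"] le[of 0 "b - a"] subspace_diff[OF sM that] subspace_diff[OF sM that(2) that(1)]
    by simp
  define g where "g v = (THE a. (v, a) \<in> M)" for v
  have g: "(v, g v) \<in> M" for v
    unfolding g_def using total uniq by (metis theI)
  have geq: "g v = a" if "(v, a) \<in> M" for v a
    using uniq g that by blast
  have bound: "\<bar>g v\<bar> \<le> norm v" for v
    using le[OF g, of v] le[of "- v" "- g v"] subspace_neg[OF sM g, of v] by simp
  have bl: "bounded_linear g"
  proof (rule bounded_linear_intro)
    show "g (v + w) = g v + g w" for v w
      using subspace_add[OF sM g g, of v w] by (intro geq) simp
    show "g (r *\<^sub>R v) = r *\<^sub>R g v" for r v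
      using subspace_scale[OF sM g, of r v] by (intro geq) simp
    show "norm (g v) \<le> norm v * 1" for v
      using bound by simp
  qed
  show ?thesis
  proof (rule that[of "Blinfun g"])
    show "norm (Blinfun g) \<le> 1"
      using bound by (intro norm_blinfun_bound) (auto simp: bounded_linear_Blinfun_apply[OF bl])
    show "blinfun_apply (Blinfun g) x = norm x"
      using geq[OF xM] by (simp add: bounded_linear_Blinfun_apply[OF bl])
  qed
qed

lemma abs_blinfun_apply_le:
  fixes f :: "'a::real_normed_vector \<Rightarrow>\<^sub>L real"
  assumes "norm f \<le> 1"
  shows "\<bar>f x\<bar> \<le> norm x"
  using norm_blinfun[of f x] mult_right_mono[OF assms, of "norm x"] by simp

lemma norm_le_dual:
  fixes x :: "'a::real_normed_vector"
  assumes "\<And>f :: 'a \<Rightarrow>\<^sub>L real. norm f \<le> 1 \<Longrightarrow> blinfun_apply f x \<le> b"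
  shows "norm x \<le> b"
  using assms norming_functional[of x] by metis

text \<open>Only the dependence of the constant on the cardinality of \<open>F\<close> matters.\<close>
lemma finite_set_norming_functional:
  fixes F :: "'a::real_normed_vector set"
  assumes "finite F"
  shows "\<exists>f :: 'a \<Rightarrow>\<^sub>L real. norm f \<le> 1 \<and> (\<forall>x\<in>F. norm x \<le> 4 ^ card F * \<bar>blinfun_apply f x\<bar>)"
  using assms
proof (induction F)
  case empty
  then show ?case by (auto intro: exI[of _ 0])
next
  case (insert x F)
  then obtain f :: "'a \<Rightarrow>\<^sub>L real" where f: "norm f \<le> 1"
    and fF: "\<And>y. y \<in> F \<Longrightarrow> norm y \<le> 4 ^ card F * \<bar>blinfun_apply f y\<bar>"
    by blast
  obtain g :: "'a \<Rightarrow>\<^sub>L real" where g: "norm g \<le> 1" "blinfun_apply g x = norm x"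
    using norming_functional .
  \<comment> \<open>A small multiple of \<open>g\<close> is added to \<open>f\<close>, with the sign
    of \<open>f x\<close> so that nothing cancels at \<open>x\<close>. The size of \<open>c\<close>
    keeps the perturbation at \<open>y\<close> in \<open>F\<close> below half of
    \<open>\<bar>f y\<bar>\<close>. The factor 4 is the product of this 2 and the 2 lost by halving
    in \<open>h\<close>.\<close>
  define c :: real where "c = 1 / (2 * 4 ^ card F)"
  have c: "0 < c" "c \<le> 1 / 2"
    by (auto simp: c_def field_simps)
  define s :: real where "s = (if 0 \<le> blinfun_apply f x then 1 else - 1)"
  define h where "h = (1 / 2) *\<^sub>R (f + (s * c) *\<^sub>R g)"
  have ha: "\<bar>blinfun_apply h y\<bar> = \<bar>blinfun_apply f y + s * c * blinfun_apply g y\<bar> / 2" for y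
    by (simp add: h_def blinfun.add_left blinfun.scaleR_left)
  have "norm (f + (s * c) *\<^sub>R g) \<le> norm f + \<bar>s * c\<bar> * norm g"
    by (rule order_trans[OF norm_triangle_ineq]) simp
  also have "\<dots> \<le> 1 + 1 * 1"
    using f g c by (intro add_mono mult_mono) (auto simp: s_def)
  finally have "norm h \<le> 1"
    by (simp add: h_def)
  moreover have "c * norm y \<le> 2 * \<bar>blinfun_apply h y\<bar>" if "y \<in> insert x F" for y
  proof (cases "y = x")
    case True
    have "c * norm x \<le> \<bar>blinfun_apply f x + s * c * norm x\<bar>"
      using c by (auto simp: s_def)
    then show ?thesis
      using True g by (simp add: ha)
  next
    case False
    then have "2 * (c * norm y) \<le> \<bar>blinfun_apply f y\<bar>"
      using fF[of y] that by (simp add: c_def field_simps)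
    moreover have "\<bar>s * c * blinfun_apply g y\<bar> \<le> c * norm y"
      using abs_blinfun_apply_le[OF g(1), of y] c by (simp add: s_def abs_mult)
    moreover have "\<bar>blinfun_apply f y\<bar> - \<bar>s * c * blinfun_apply g y\<bar> \<le>
        \<bar>blinfun_apply f y + s * c * blinfun_apply g y\<bar>"
      using abs_triangle_ineq2[of "blinfun_apply f y" "- (s * c * blinfun_apply g y)"] by simp
    ultimately show ?thesis
      unfolding ha by simp
  qed
  ultimately show ?case
    using insert.hyps by (intro exI[of _ h]) (auto simp: c_def field_simps)
qed

section \<open>Uniform weak nullity forces the arithmetic means to 0\<close>

section \<open>Means of uniformly weakly null sequences\<close>

text \<open>Let \<open>n\<close> be the bound for threshold 1. An unbounded set has
  \<open>Suc n\<close> members of norm greater than \<open>4 ^ Suc n\<close>, and a single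
  functional norming all of them up to this factor exceeds 1 on each.\<close>

lemma uniformly_weakly_null_set_bounded:
  fixes A :: "'a::real_normed_vector set"
  assumes "uniformly_weakly_null_set A"
  shows "bounded A"
proof (rule ccontr)
  assume nb: "\<not> bounded A"
  obtain n where n: "\<And>f :: 'a \<Rightarrow>\<^sub>L real. norm f \<le> 1 \<Longrightarrow>
      finite {x \<in> A. \<bar>blinfun_apply f x\<bar> > 1} \<and> card {x \<in> A. \<bar>blinfun_apply f x\<bar> > 1} \<le> n"
    using assms unfolding uniformly_weakly_null_set_def by (meson zero_less_one)
  define R :: real where "R = 4 ^ Suc n"
  have "A \<subseteq> cball 0 R \<union> {x \<in> A. norm x > R}"
    by auto
  then have "infinite {x \<in> A. norm x > R}"
    using nb by (meson bounded_Un bounded_cball bounded_subset finite_imp_bounded)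
  then obtain F where F: "finite F" "card F = Suc n" "F \<subseteq> {x \<in> A. norm x > R}"
    by (meson infinite_arbitrarily_large)
  obtain f :: "'a \<Rightarrow>\<^sub>L real" where f: "norm f \<le> 1" "\<And>x. x \<in> F \<Longrightarrow> norm x \<le> R * \<bar>blinfun_apply f x\<bar>"
    using finite_set_norming_functional[OF F(1)] F(2) by (auto simp: R_def)
  have "1 < \<bar>blinfun_apply f x\<bar>" if "x \<in> F" for x
  proof -
    have "R * 1 < R * \<bar>blinfun_apply f x\<bar>"
      using f(2)[OF that] F(3) that by force
    then show ?thesis by (simp add: R_def)
  qed
  then have "F \<subseteq> {x \<in> A. \<bar>blinfun_apply f x\<bar> > 1}"
    using F by auto
  then have "card F \<le> n"
    using n[OF f(1)] by (meson card_mono le_trans)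
  then show False
    using F by simp
qed

lemma uniformly_weakly_null_set_subset:
  assumes "uniformly_weakly_null_set B" "A \<subseteq> B"
  shows "uniformly_weakly_null_set A"
  unfolding uniformly_weakly_null_set_def
proof (intro allI impI)
  fix \<epsilon> :: real assume "\<epsilon> > 0"
  then obtain n where n: "\<forall>f :: 'a \<Rightarrow>\<^sub>L real. norm f \<le> 1 \<longrightarrow>
        finite {x \<in> B. \<bar>blinfun_apply f x\<bar> > \<epsilon>} \<and> card {x \<in> B. \<bar>blinfun_apply f x\<bar> > \<epsilon>} \<le> n"
    using assms(1) unfolding uniformly_weakly_null_set_def by blast
  have "{x \<in> A. \<bar>blinfun_apply f x\<bar> > \<epsilon>} \<subseteq> {x \<in> B. \<bar>blinfun_apply f x\<bar> > \<epsilon>}" for f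
    using assms(2) by auto
  with n show "\<exists>n. \<forall>f :: 'a \<Rightarrow>\<^sub>L real. norm f \<le> 1 \<longrightarrow>
        finite {x \<in> A. \<bar>blinfun_apply f x\<bar> > \<epsilon>} \<and> card {x \<in> A. \<bar>blinfun_apply f x\<bar> > \<epsilon>} \<le> n"
    by (meson card_mono finite_subset le_trans)
qed

lemma Cesaro_mean_diff:
  fixes x :: "nat \<Rightarrow> 'a::real_normed_vector"
  assumes "0 < n"
  shows "(\<Sum>k<n. x k - l) /\<^sub>R real n = (\<Sum>k<n. x k) /\<^sub>R real n - l"
  using assms by (simp add: sum_subtractf scaleR_diff_right sum_constant_scaleR)

lemma Cesaro_tendsto_diff_iff:
  fixes x :: "nat \<Rightarrow> 'a::real_normed_vector"
  shows "(\<lambda>n. (\<Sum>k<n. x k - l) /\<^sub>R real n) \<longlonglongrightarrow> 0 \<longleftrightarrow> (\<lambda>n. (\<Sum>k<n. x k) /\<^sub>R real n) \<longlonglongrightarrow> l"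
proof -
  have "(\<lambda>n. (\<Sum>k<n. x k - l) /\<^sub>R real n) \<longlonglongrightarrow> 0 \<longleftrightarrow> (\<lambda>n. (\<Sum>k<n. x k) /\<^sub>R real n - l) \<longlonglongrightarrow> 0"
    by (intro tendsto_cong eventually_mono[OF eventually_gt_at_top[of 0]] Cesaro_mean_diff)
  then show ?thesis
    by (simp add: LIM_zero_iff)
qed

text \<open>Under a functional of norm at most 1, all but \<open>N\<close> terms contribute at most
  \<open>\<epsilon> / 2\<close> and the others at most \<open>C\<close>. As \<open>N\<close> does
  not depend on the functional, this bounds the norm of the sum. Injectivity turns the bound on the
  number of vectors into one on the number of indices.\<close>

lemma uniformly_weakly_null_set_Cesaro:
  fixes y :: "nat \<Rightarrow> 'a::real_normed_vector"
  assumes uwn: "uniformly_weakly_null_set (range y)" and "inj y"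
  shows "(\<lambda>n. (\<Sum>k<n. y k) /\<^sub>R real n) \<longlonglongrightarrow> 0"
proof (rule LIMSEQ_I)
  fix \<epsilon> :: real assume "0 < \<epsilon>"
  obtain C where C: "\<And>k. norm (y k) \<le> C"
    using uniformly_weakly_null_set_bounded[OF uwn] by (auto simp: bounded_iff)
  obtain N where N: "\<And>f :: 'a \<Rightarrow>\<^sub>L real. norm f \<le> 1 \<Longrightarrow>
      finite {x \<in> range y. \<bar>blinfun_apply f x\<bar> > \<epsilon> / 2} \<and>
      card {x \<in> range y. \<bar>blinfun_apply f x\<bar> > \<epsilon> / 2} \<le> N"
    using uwn \<open>0 < \<epsilon>\<close> unfolding uniformly_weakly_null_set_def by (meson half_gt_zero)
  have "0 \<le> C"
    using C[of 0] norm_ge_zero order_trans by blast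
  have sum_le: "norm (\<Sum>k<n. y k) \<le> real n * (\<epsilon> / 2) + real N * C" for n
  proof (rule norm_le_dual)
    fix f :: "'a \<Rightarrow>\<^sub>L real" assume f: "norm f \<le> 1"
    let ?B = "{k \<in> {..<n}. \<bar>blinfun_apply f (y k)\<bar> > \<epsilon> / 2}"
    have "blinfun_apply f (\<Sum>k<n. y k) = (\<Sum>k<n. blinfun_apply f (y k))"
      by (simp add: blinfun.sum_right)
    also have "\<dots> \<le> (\<Sum>k<n. \<epsilon> / 2 + (if \<bar>blinfun_apply f (y k)\<bar> > \<epsilon> / 2 then C else 0))"
      using abs_blinfun_apply_le[OF f] C \<open>0 < \<epsilon>\<close> by (intro sum_mono) (smt (verit) field_sum_of_halves)
    also have "\<dots> = real n * (\<epsilon> / 2) + real (card ?B) * C"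
      by (simp add: sum.distrib flip: sum.inter_filter)
    also have "card ?B \<le> N"
    proof -
      have "card ?B = card (y ` ?B)"
        by (rule card_image[symmetric]) (rule inj_on_subset[OF \<open>inj y\<close> subset_UNIV])
      also have "\<dots> \<le> card {x \<in> range y. \<bar>blinfun_apply f x\<bar> > \<epsilon> / 2}"
        using N[OF f] by (intro card_mono) auto
      finally show ?thesis
        using N[OF f] by linarith
    qed
    finally show "blinfun_apply f (\<Sum>k<n. y k) \<le> real n * (\<epsilon> / 2) + real N * C"
      using \<open>0 \<le> C\<close> by (simp add: mult_right_mono)
  qed
  obtain n0 :: nat where n0: "real N * C * 2 / \<epsilon> < n0"
    using reals_Archimedean2 by blast
  have "norm ((\<Sum>k<n. y k) /\<^sub>R real n - 0) < \<epsilon>" if "n0 \<le> n" for n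
  proof -
    have n: "real N * C * 2 / \<epsilon> < n"
      using n0 that by linarith
    moreover have "0 \<le> real N * C * 2 / \<epsilon>"
      using \<open>0 \<le> C\<close> \<open>0 < \<epsilon>\<close> by simp
    ultimately have "0 < real n"
      by linarith
    moreover have "norm (\<Sum>k<n. y k) < real n * \<epsilon>"
      using sum_le[of n] n \<open>0 < \<epsilon>\<close> by (simp add: field_simps)
    ultimately show ?thesis
      by (simp add: field_simps)
  qed
  then show "\<exists>n0. \<forall>n\<ge>n0. norm ((\<Sum>k<n. y k) /\<^sub>R real n - 0) < \<epsilon>"
    by blast
qed

text \<open>The hypothesis controls only the range of the sequence. If the range is finite, some
  subsequence is constant; if it is infinite, some subsequence is injective and its means are
  already known to converge.\<close>

lemma Banach_Saks_if_uniformly_weakly_convergent: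
  fixes A :: "'a::real_normed_vector set"
  assumes "\<And>x :: nat \<Rightarrow> 'a. range x \<subseteq> A \<Longrightarrow> \<exists>r. strict_mono r \<and> uniformly_weakly_convergent (x \<circ> r)"
  shows "Banach_Saks_set A"
  unfolding Banach_Saks_set_def
proof (intro allI impI)
  fix x :: "nat \<Rightarrow> 'a" assume "range x \<subseteq> A"
  from assms[OF this] obtain r :: "nat \<Rightarrow> nat" and l
    where r: "strict_mono r" and l: "uniformly_weakly_null_set (range (\<lambda>n. x (r n) - l))"
    unfolding uniformly_weakly_convergent_def uniformly_weakly_null_def o_def by blast
  define y where "y n = x (r n) - l" for n
  have "\<exists>s l'. strict_mono s \<and> (\<lambda>n. (\<Sum>k<n. x (r (s k))) /\<^sub>R real n) \<longlonglongrightarrow> l'"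
  proof (cases "finite (range y)")
    case True
    then obtain n0 where inf: "infinite {n. y n = y n0}"
      using pigeonhole_infinite[of UNIV y] by auto
    define s where "s = enumerate {n. y n = y n0}"
    have "x (r (s n)) = x (r n0)" for n
      using enumerate_in_set[OF inf, of n] by (simp add: s_def y_def)
    then have "(\<lambda>n. (\<Sum>k<n. x (r (s k)) - x (r n0)) /\<^sub>R real n) \<longlonglongrightarrow> 0"
      by simp
    moreover have "strict_mono s"
      using inf by (simp add: s_def strict_mono_enumerate)
    ultimately show ?thesis
      using Cesaro_tendsto_diff_iff[of "\<lambda>k. x (r (s k))" "x (r n0)"] by blast
  next
    case False
    \<comment> \<open>\<open>I\<close> keeps the first occurrence of every value: the range stays
      the same and \<open>y\<close> becomes injective.\<close>
    define I where "I = {n. \<forall>m<n. y m \<noteq> y n}"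
    have "y n \<in> y ` I" for n
    proof -
      define m where "m = (LEAST m. y m = y n)"
      have "y m = y n"
        unfolding m_def by (rule LeastI[of _ n]) simp
      moreover have "y m' \<noteq> y n" if "m' < m" for m'
        using that unfolding m_def by (rule not_less_Least)
      ultimately have "m \<in> I"
        by (simp add: I_def)
      with \<open>y m = y n\<close> show ?thesis
        by (metis imageI)
    qed
    then have "range y \<subseteq> y ` I" by blast
    then have inf: "infinite I"
      using False finite_subset by blast
    define s where "s = enumerate I"
    have s: "strict_mono s" "range s = I"
      using inf by (auto simp: s_def strict_mono_enumerate range_enumerate)
    have "inj_on y I"
    proof (rule inj_onI)
      fix m n assume "m \<in> I" "n \<in> I" "y m = y n"
      then have "\<not> m < n" "\<not> n < m"
        unfolding I_def by force+
      then show "m = n" by simp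
    qed
    then have "inj (\<lambda>n. y (s n))"
      using comp_inj_on[of s UNIV y] s strict_mono_imp_inj_on by (auto simp: o_def)
    moreover have "uniformly_weakly_null_set (range (\<lambda>n. y (s n)))"
      by (rule uniformly_weakly_null_set_subset[OF l]) (unfold y_def, blast)
    ultimately have "(\<lambda>n. (\<Sum>k<n. y (s k)) /\<^sub>R real n) \<longlonglongrightarrow> 0"
      by (rule uniformly_weakly_null_set_Cesaro[rotated])
    then show ?thesis
      using s(1) Cesaro_tendsto_diff_iff[of "\<lambda>k. x (r (s k))" l] unfolding y_def by blast
  qed
  then obtain s :: "nat \<Rightarrow> nat" and l' where "strict_mono s" "(\<lambda>n. (\<Sum>k<n. x (r (s k))) /\<^sub>R real n) \<longlonglongrightarrow> l'"
    by blast
  then show "\<exists>r. strict_mono r \<and> Cesaro_convergent (x \<circ> r)"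
    using strict_mono_o[OF r] by (intro exI[of _ "r \<circ> s"]) (auto simp: Cesaro_convergent_def convergent_def)
qed

section \<open>Ramsey's theorem, diagonal subsequences and consequences of Cesaro
  convergence\<close>

section \<open>Subsequences\<close>

text \<open>Ramsey's theorem with two colours on the \<open>k\<close>-subsets of
  \<open>range s\<close>. The homogeneous set is presented as a refinement of \<open>s\<close>, the
  form that the diagonal argument takes as input.\<close>

lemma Ramsey_subseq:
  fixes s :: "nat \<Rightarrow> nat"
  assumes s: "strict_mono s"
  obtains r :: "nat \<Rightarrow> nat" where "strict_mono r"
    "(\<forall>S. finite S \<longrightarrow> card S = k \<longrightarrow> S \<subseteq> range (s \<circ> r) \<longrightarrow> P S) \<or>
     (\<forall>S. finite S \<longrightarrow> card S = k \<longrightarrow> S \<subseteq> range (s \<circ> r) \<longrightarrow> \<not> P S)"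
proof -
  have "infinite (range s)"
    using s by (simp add: range_inj_infinite strict_mono_imp_inj_on)
  define f :: "nat set \<Rightarrow> nat" where "f X = (if P X then 0 else 1)" for X
  have "\<forall>X. X \<subseteq> range s \<and> finite X \<and> card X = k \<longrightarrow> f X < 2"
    by (simp add: f_def)
  from Ramsey[OF \<open>infinite (range s)\<close> this] obtain Y t where Y: "Y \<subseteq> range s" "infinite Y"
    and t: "\<And>X. X \<subseteq> Y \<Longrightarrow> finite X \<Longrightarrow> card X = k \<Longrightarrow> f X = t"
    by metis
  have "infinite (s -` Y)"
  proof
    assume "finite (s -` Y)"
    then have "finite (s ` (s -` Y))"
      by (rule finite_imageI)
    moreover have "s ` (s -` Y) = Y"
      using Y(1) by blast
    ultimately show False
      using Y(2) by simp
  qed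
  define r where "r = enumerate (s -` Y)"
  have "range r = s -` Y" "strict_mono r"
    using \<open>infinite (s -` Y)\<close> by (auto simp: r_def range_enumerate strict_mono_enumerate)
  have "s (r i) \<in> Y" for i
    using \<open>range r = s -` Y\<close> by blast
  then have "range (s \<circ> r) \<subseteq> Y" by auto
  have *: "P S \<longleftrightarrow> t = 0" if "finite S" "card S = k" "S \<subseteq> range (s \<circ> r)" for S
  proof -
    have "f S = t"
      by (rule t[OF subset_trans[OF that(3) \<open>range (s \<circ> r) \<subseteq> Y\<close>] that(1,2)])
    then show ?thesis
      by (cases "P S") (auto simp: f_def)
  qed
  show ?thesis
  proof (cases "t = 0")
    case True
    then show ?thesis
      using * by (intro that[OF \<open>strict_mono r\<close>] disjI1) blast
  next
    case False
    then show ?thesis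
      using * by (intro that[OF \<open>strict_mono r\<close>] disjI2) blast
  qed
qed

text \<open>Only from position \<open>Suc k\<close> on is the diagonal sequence a subsequence of a
  sequence with the \<open>k\<close>-th property, so only tails inherit it.\<close>

lemma diagonal_subseq:
  fixes Q :: "nat \<Rightarrow> (nat \<Rightarrow> nat) \<Rightarrow> bool"
  assumes "\<And>n (s :: nat \<Rightarrow> nat). strict_mono s \<Longrightarrow> \<exists>r. strict_mono r \<and> Q n (s \<circ> r)"
    and "\<And>n s r. strict_mono r \<Longrightarrow> Q n s \<Longrightarrow> Q n (s \<circ> r)"
  obtains d where "strict_mono d" "\<And>k. Q k (d \<circ> (+) (Suc k))"
proof -
  interpret subseqs Q
    by unfold_locales (rule assms(1))
  show ?thesis
    using that[OF subseq_diagseq] diagseq_holds assms(2) by blast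
qed

lemma Cesaro_tendsto:
  fixes a :: "nat \<Rightarrow> real"
  assumes a: "a \<longlonglongrightarrow> L"
  shows "(\<lambda>n. (\<Sum>k<n. a k) /\<^sub>R real n) \<longlonglongrightarrow> L"
proof (rule Cesaro_tendsto_diff_iff[THEN iffD1], rule LIMSEQ_I)
  fix \<epsilon> :: real assume "0 < \<epsilon>"
  define b where "b k = \<bar>a k - L\<bar>" for k
  obtain p where p: "\<And>k. k \<ge> p \<Longrightarrow> b k \<le> \<epsilon> / 2"
    using LIMSEQ_D[OF a, of "\<epsilon> / 2"] \<open>0 < \<epsilon>\<close> by (auto simp: b_def intro: less_imp_le)
  have "(\<lambda>n. (\<Sum>k<p. b k) / real n) \<longlonglongrightarrow> 0"
    by (rule lim_const_over_n)
  from LIMSEQ_D[OF this, of "\<epsilon> / 2"] obtain q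
    where q: "\<And>n. n \<ge> q \<Longrightarrow> \<bar>(\<Sum>k<p. b k) / real n\<bar> < \<epsilon> / 2"
    using \<open>0 < \<epsilon>\<close> by auto
  have "norm ((\<Sum>k<n. a k - L) /\<^sub>R real n - 0) < \<epsilon>" if n: "n \<ge> Suc (max p q)" for n
  proof -
    have "\<bar>\<Sum>k<n. a k - L\<bar> \<le> (\<Sum>k<n. b k)"
      unfolding b_def by (rule sum_abs)
    also have "\<dots> = (\<Sum>k<p. b k) + (\<Sum>k=p..<n. b k)"
      using n by (simp add: lessThan_atLeast0 sum.atLeastLessThan_concat)
    finally have "\<bar>\<Sum>k<n. a k - L\<bar> \<le> (\<Sum>k<p. b k) + (\<Sum>k=p..<n. b k)" .
    moreover have "(\<Sum>k=p..<n. b k) \<le> real (card {p..<n}) * (\<epsilon> / 2)"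
      using p by (intro sum_bounded_above) auto
    moreover have "real (card {p..<n}) * (\<epsilon> / 2) \<le> real n * (\<epsilon> / 2)"
      using \<open>0 < \<epsilon>\<close> by (intro mult_right_mono) auto
    moreover have "(\<Sum>k<p. b k) / real n < \<epsilon> / 2"
      using q[of n] n by linarith
    then have "(\<Sum>k<p. b k) < real n * (\<epsilon> / 2)"
      using n by (simp add: field_simps)
    ultimately have "\<bar>\<Sum>k<n. a k - L\<bar> < real n * \<epsilon>"
      by simp
    then show ?thesis
      using n by (simp add: field_simps)
  qed
  then show "\<exists>n0. \<forall>n\<ge>n0. norm ((\<Sum>k<n. a k - L) /\<^sub>R real n - 0) < \<epsilon>"
    by blast
qed

text \<open>If the means converge, the last term divided by the number of terms tends to 0. This
  fails along every subsequence of a sequence with \<open>norm (x n) > n\<close>.\<close>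

lemma Banach_Saks_set_bounded:
  fixes A :: "'a::real_normed_vector set"
  assumes "Banach_Saks_set A"
  shows "bounded A"
proof (rule ccontr)
  assume "\<not> bounded A"
  then have "\<forall>n. \<exists>v\<in>A. real n < norm v"
    by (meson bounded_iff not_le)
  then obtain x where xA: "\<And>n. x n \<in> A" and x: "\<And>n. real n < norm (x n)"
    by metis
  have "range x \<subseteq> A"
    using xA by auto
  then obtain r l where r: "strict_mono r" and l: "(\<lambda>n. (\<Sum>k<n. x (r k)) /\<^sub>R real n) \<longlonglongrightarrow> l"
    using assms unfolding Banach_Saks_set_def Cesaro_convergent_def convergent_def o_def by blast
  define S where "S n = (\<Sum>k<n. x (r k))" for n
  have "(\<lambda>n. S (Suc n) /\<^sub>R real (Suc n)) \<longlonglongrightarrow> l"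
    using LIMSEQ_Suc[OF l] by (simp add: S_def)
  moreover have "(\<lambda>n. (real n / real (Suc n)) *\<^sub>R (S n /\<^sub>R real n)) \<longlonglongrightarrow> 1 *\<^sub>R l"
    using l unfolding S_def by (intro tendsto_scaleR LIMSEQ_n_over_Suc_n)
  ultimately have "(\<lambda>n. S (Suc n) /\<^sub>R real (Suc n) - (real n / real (Suc n)) *\<^sub>R (S n /\<^sub>R real n)) \<longlonglongrightarrow> l - 1 *\<^sub>R l"
    by (rule tendsto_diff)
  moreover have "S (Suc n) /\<^sub>R real (Suc n) - (real n / real (Suc n)) *\<^sub>R (S n /\<^sub>R real n) = x (r n) /\<^sub>R real (Suc n)" for n
  proof -
    have "(real n / real (Suc n)) *\<^sub>R (S n /\<^sub>R real n) = S n /\<^sub>R real (Suc n)"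
      by (cases "n = 0") (simp_all add: S_def inverse_eq_divide)
    then show ?thesis
      by (simp only: S_def sum.lessThan_Suc scaleR_add_right add_diff_cancel_left')
  qed
  ultimately have "(\<lambda>n. x (r n) /\<^sub>R real (Suc n)) \<longlonglongrightarrow> 0"
    by (simp only: scaleR_one diff_self)
  from LIMSEQ_D[OF this, of "1 / 2"] obtain n0 where
    n0: "\<And>n. n \<ge> n0 \<Longrightarrow> norm (x (r n) /\<^sub>R real (Suc n)) < 1 / 2"
    by auto
  \<comment> \<open>The final inequality \<open>n < (n + 1) / 2\<close> is absurd only for positive
    \<open>n\<close>, hence \<open>Suc\<close>.\<close>
  define n where "n = Suc n0"
  have "norm (x (r n) /\<^sub>R real (Suc n)) < 1 / 2"
    by (rule n0) (simp add: n_def)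
  then have "norm (x (r n)) < (real n + 1) / 2"
    by (simp add: field_simps)
  moreover have "n \<le> r n"
    by (rule seq_suble[OF r])
  then have "real n < norm (x (r n))"
    using x[of "r n"] by linarith
  ultimately have "real n < (real n + 1) / 2"
    by (rule less_trans[rotated])
  then show False
    by (simp add: n_def)
qed

section \<open>From the Banach-Saks property to uniform weak convergence\<close>

section \<open>Uniform weak convergence in Banach-Saks sets\<close>

text \<open>Differences of averages over finite index sets form a countable set \<open>D\<close>,
  and a difference of two Cesaro limits is a norm limit of members of \<open>D\<close>. Along
  \<open>r\<close> the norming functional of every member of \<open>D\<close> converges, so it takes
  equal values at all Cesaro limits of subsequences. Functionals that norm vectors arbitrarily close
  to \<open>l - l'\<close> then vanish at \<open>l - l'\<close>, which forces
  \<open>l = l'\<close>.\<close>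

lemma subseq_unique_Cesaro_limit:
  fixes x :: "nat \<Rightarrow> 'a::real_normed_vector"
  assumes bdd: "bounded (range x)"
  obtains r :: "nat \<Rightarrow> nat" where "strict_mono r"
    "\<And>(s :: nat \<Rightarrow> nat) (s' :: nat \<Rightarrow> nat) l l'. strict_mono s \<Longrightarrow> strict_mono s' \<Longrightarrow>
      (\<lambda>n. (\<Sum>k<n. x (r (s k))) /\<^sub>R real n) \<longlonglongrightarrow> l \<Longrightarrow>
      (\<lambda>n. (\<Sum>k<n. x (r (s' k))) /\<^sub>R real n) \<longlonglongrightarrow> l' \<Longrightarrow> l = l'"
proof -
  define avg where "avg F = (\<Sum>k\<in>F. x k) /\<^sub>R real (card F)" for F
  define D where "D = (\<lambda>(F, G). avg F - avg G) ` (Collect finite \<times> Collect finite)"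
  have "countable D"
    unfolding D_def by (intro countable_image countable_SIGMA countable_Collect_finite)
  have "D \<noteq> {}"
    unfolding D_def by blast
  define e where "e = from_nat_into D"
  have e: "\<exists>k. e k = d" if "d \<in> D" for d
    using from_nat_into_surj[OF \<open>countable D\<close> that] by (simp add: e_def)
  have "\<exists>g :: 'a \<Rightarrow>\<^sub>L real. norm g \<le> 1 \<and> blinfun_apply g (e k) = norm (e k)" for k
    using norming_functional[of "e k"] by blast
  then obtain f :: "nat \<Rightarrow> 'a \<Rightarrow>\<^sub>L real" where f: "\<And>k. norm (f k) \<le> 1"
    and fe: "\<And>k. blinfun_apply (f k) (e k) = norm (e k)"
    by metis
  define Q where "Q k s \<longleftrightarrow> convergent (\<lambda>n. blinfun_apply (f k) (x (s n)))" for k and s :: "nat \<Rightarrow> nat"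
  obtain C where C: "\<And>n. norm (x n) \<le> C"
    using bdd by (auto simp: bounded_iff)
  obtain r where r: "strict_mono r" and Qr: "\<And>k. Q k (r \<circ> (+) (Suc k))"
  proof (rule diagonal_subseq[of Q])
    show "\<exists>r. strict_mono r \<and> Q k (s \<circ> r)" for k and s :: "nat \<Rightarrow> nat"
    proof -
      have "norm (blinfun_apply (f k) (x (s n))) \<le> C" for n
        using abs_blinfun_apply_le[OF f, of k "x (s n)"] C[of "s n"] by simp
      then have "bounded (range (\<lambda>n. blinfun_apply (f k) (x (s n))))"
        unfolding bounded_iff by blast
      then obtain l r where "strict_mono (r :: nat \<Rightarrow> nat)"
        "((\<lambda>n. blinfun_apply (f k) (x (s n))) \<circ> r) \<longlonglongrightarrow> l"
        using bounded_imp_convergent_subsequence by blast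
      then show ?thesis
        unfolding Q_def convergent_def o_def by blast
    qed
    show "Q k (s \<circ> r)" if "strict_mono r" "Q k s" for k s and r :: "nat \<Rightarrow> nat"
      using convergent_subseq_convergent[of "\<lambda>n. blinfun_apply (f k) (x (s n))" r] that
      by (simp add: Q_def o_def)
  qed blast
  have "convergent (\<lambda>n. blinfun_apply (f k) (x (r n)))" for k
    using Qr[of k] convergent_ignore_initial_segment[of "\<lambda>n. blinfun_apply (f k) (x (r n))" "Suc k"]
    by (simp add: Q_def o_def add.commute)
  then obtain L where L: "\<And>k. (\<lambda>n. blinfun_apply (f k) (x (r n))) \<longlonglongrightarrow> L k"
    unfolding convergent_def by metis
  have fL: "blinfun_apply (f k) l = L k"
    if s: "strict_mono s" and l: "(\<lambda>n. (\<Sum>k<n. x (r (s k))) /\<^sub>R real n) \<longlonglongrightarrow> l"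
    for s :: "nat \<Rightarrow> nat" and l k
  proof -
    have "(\<lambda>n. blinfun_apply (f k) ((\<Sum>i<n. x (r (s i))) /\<^sub>R real n)) \<longlonglongrightarrow> blinfun_apply (f k) l"
      using l by (intro tendsto_intros)
    then have "(\<lambda>n. (\<Sum>i<n. blinfun_apply (f k) (x (r (s i)))) /\<^sub>R real n) \<longlonglongrightarrow> blinfun_apply (f k) l"
      by (simp add: blinfun.scaleR_right blinfun.sum_right)
    moreover have "(\<lambda>n. blinfun_apply (f k) (x (r (s n)))) \<longlonglongrightarrow> L k"
      using LIMSEQ_subseq_LIMSEQ[OF L s] by (simp add: o_def)
    from Cesaro_tendsto[OF this]
    have "(\<lambda>n. (\<Sum>i<n. blinfun_apply (f k) (x (r (s i)))) /\<^sub>R real n) \<longlonglongrightarrow> L k" .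
    ultimately show ?thesis
      by (rule LIMSEQ_unique)
  qed
  have mean: "(\<Sum>k<n. x (r (s k))) /\<^sub>R real n = avg ((\<lambda>k. r (s k)) ` {..<n})"
    if s: "strict_mono s" for s :: "nat \<Rightarrow> nat" and n
  proof -
    have "inj_on (\<lambda>k. r (s k)) {..<n}"
      using strict_mono_o[OF r s] by (auto simp: o_def intro: strict_mono_imp_inj_on inj_on_subset)
    then show ?thesis
      by (simp add: avg_def sum.reindex card_image)
  qed
  show ?thesis
  proof (rule that[OF r])
    fix s s' :: "nat \<Rightarrow> nat" and l l'
    assume s: "strict_mono s" and s': "strict_mono s'"
      and l: "(\<lambda>n. (\<Sum>k<n. x (r (s k))) /\<^sub>R real n) \<longlonglongrightarrow> l"
      and l': "(\<lambda>n. (\<Sum>k<n. x (r (s' k))) /\<^sub>R real n) \<longlonglongrightarrow> l'"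
    show "l = l'"
    proof (rule ccontr)
      assume "l \<noteq> l'"
      then have "0 < norm (l - l') / 2" by simp
      from LIMSEQ_D[OF tendsto_diff[OF l l'] this] obtain n where
        n: "norm ((\<Sum>k<n. x (r (s k))) /\<^sub>R real n - (\<Sum>k<n. x (r (s' k))) /\<^sub>R real n - (l - l')) < norm (l - l') / 2"
        by blast
      have "(\<Sum>k<n. x (r (s k))) /\<^sub>R real n - (\<Sum>k<n. x (r (s' k))) /\<^sub>R real n \<in> D"
        unfolding D_def mean[OF s] mean[OF s'] by (rule image_eqI[of _ _ "(_, _)"]) auto
      from e[OF this] obtain k where ek: "norm (e k - (l - l')) < norm (l - l') / 2"
        using n by metis
      \<comment> \<open>The functional \<open>f k\<close> norms \<open>e k\<close> and vanishes at
        \<open>l - l'\<close>, so \<open>e k\<close> is no longer than its distance to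
        \<open>l - l'\<close>.\<close>
      have "norm (e k) = blinfun_apply (f k) (e k - (l - l'))"
        using fL[OF s l, of k] fL[OF s' l', of k] by (simp add: fe blinfun.diff_right)
      also have "\<dots> \<le> norm (e k - (l - l'))"
        using abs_blinfun_apply_le[OF f, of k "e k - (l - l')"] by simp
      finally have "norm (e k) \<le> norm (e k - (l - l'))" .
      moreover have "norm (l - l') \<le> norm (e k) + norm (e k - (l - l'))"
        using norm_triangle_ineq4[of "e k" "e k - (l - l')"] by simp
      ultimately show False
        using ek by simp
    qed
  qed
qed

text \<open>There is no absolute value, so that the values add up without cancellation; negative
  values are handled later through \<open>- f\<close>.\<close>

definition jointly_large :: "(nat \<Rightarrow> 'a::real_normed_vector) \<Rightarrow> real \<Rightarrow> nat set \<Rightarrow> bool" where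
  "jointly_large z \<epsilon> S \<longleftrightarrow> (\<exists>f :: 'a \<Rightarrow>\<^sub>L real. norm f \<le> 1 \<and> (\<forall>n\<in>S. \<epsilon> < blinfun_apply f (z n)))"

text \<open>Otherwise Ramsey's theorem always returns the jointly large alternative, and a diagonal
  sequence has it for every cardinality. Along a further subsequence whose means tend to 0, the
  block from \<open>n\<close> to \<open>2 * n\<close> then has an average of norm at least
  \<open>\<epsilon>\<close>.\<close>

lemma subseq_not_jointly_large:
  fixes z :: "nat \<Rightarrow> 'a::real_normed_vector" and s :: "nat \<Rightarrow> nat"
  assumes Ces: "\<And>u :: nat \<Rightarrow> nat. strict_mono u \<Longrightarrow>
      \<exists>v :: nat \<Rightarrow> nat. strict_mono v \<and> (\<lambda>n. (\<Sum>k<n. z (u (v k))) /\<^sub>R real n) \<longlonglongrightarrow> 0"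
    and "0 < \<epsilon>" and s: "strict_mono s"
  shows "\<exists>r :: nat \<Rightarrow> nat. strict_mono r \<and> (\<exists>k. \<forall>S. finite S \<longrightarrow> card S = k \<longrightarrow> S \<subseteq> range (s \<circ> r) \<longrightarrow> \<not> jointly_large z \<epsilon> S)"
proof (rule ccontr)
  assume contra: "\<not> ?thesis"
  define Q where "Q k t \<longleftrightarrow> (\<forall>S. finite S \<longrightarrow> card S = Suc k \<longrightarrow> S \<subseteq> range (s \<circ> t) \<longrightarrow> jointly_large z \<epsilon> S)"
    for k and t :: "nat \<Rightarrow> nat"
  obtain d where d: "strict_mono d" and Qd: "\<And>k. Q k (d \<circ> (+) (Suc k))"
  proof (rule diagonal_subseq[of Q])
    show "\<exists>r. strict_mono r \<and> Q k (t \<circ> r)" if t: "strict_mono t" for k and t :: "nat \<Rightarrow> nat"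
    proof -
      obtain r :: "nat \<Rightarrow> nat" where r: "strict_mono r" and
        alt: "(\<forall>S. finite S \<longrightarrow> card S = Suc k \<longrightarrow> S \<subseteq> range ((s \<circ> t) \<circ> r) \<longrightarrow> jointly_large z \<epsilon> S) \<or>
         (\<forall>S. finite S \<longrightarrow> card S = Suc k \<longrightarrow> S \<subseteq> range ((s \<circ> t) \<circ> r) \<longrightarrow> \<not> jointly_large z \<epsilon> S)"
        by (rule Ramsey_subseq[OF strict_mono_o[OF s t], of "Suc k" "jointly_large z \<epsilon>"]) (rule that)
      have "\<not> (\<forall>S. finite S \<longrightarrow> card S = Suc k \<longrightarrow> S \<subseteq> range (s \<circ> (t \<circ> r)) \<longrightarrow> \<not> jointly_large z \<epsilon> S)"
        using contra strict_mono_o[OF t r] by blast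
      with alt have "Q k (t \<circ> r)"
        unfolding Q_def o_assoc by blast
      with r show ?thesis by blast
    qed
    show "Q k (t \<circ> r)" if "strict_mono r" "Q k t" for k t and r :: "nat \<Rightarrow> nat"
    proof -
      have "range (s \<circ> (t \<circ> r)) \<subseteq> range (s \<circ> t)" by auto
      with \<open>Q k t\<close> show ?thesis
        unfolding Q_def by (meson subset_trans)
    qed
  qed blast
  have sd: "strict_mono (\<lambda>i. s (d i))"
    using strict_mono_o[OF s d] by (simp add: o_def)
  from Ces[OF this] obtain v :: "nat \<Rightarrow> nat" where v: "strict_mono v"
    and lim: "(\<lambda>n. (\<Sum>k<n. z (s (d (v k)))) /\<^sub>R real n) \<longlonglongrightarrow> 0"
    by blast
  define w where "w i = z (s (d (v i)))" for i
  define M where "M n = (\<Sum>k<n. w k) /\<^sub>R real n" for n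
  have "M \<longlonglongrightarrow> 0"
    using lim by (simp add: M_def[abs_def] w_def)
  from LIMSEQ_D[OF this, of "\<epsilon> / 4"] obtain n0 where n0: "\<And>n. n \<ge> n0 \<Longrightarrow> norm (M n) < \<epsilon> / 4"
    using \<open>0 < \<epsilon>\<close> by auto
  \<comment> \<open>\<open>Q n0\<close> concerns sets of \<open>n\<close> indices in the tail from
    position \<open>n\<close> on, and \<open>v i \<ge> i\<close> places the whole block in that
    tail.\<close>
  define n where "n = Suc n0"
  define S where "S = (\<lambda>i. s (d (v i))) ` {n..<2 * n}"
  have "inj (\<lambda>i. s (d (v i)))"
    using strict_mono_imp_inj_on[OF strict_mono_o[OF sd v]] by (simp add: o_def)
  then have "card S = Suc n0"
    by (simp add: S_def n_def card_image inj_on_subset)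
  moreover have "S \<subseteq> range (s \<circ> (d \<circ> (+) (Suc n0)))"
  proof
    fix m assume "m \<in> S"
    then obtain i where i: "n \<le> i" "m = s (d (v i))"
      by (auto simp: S_def)
    have "Suc n0 \<le> v i"
      using seq_suble[OF v, of i] i(1) by (simp add: n_def)
    then have "m = (s \<circ> (d \<circ> (+) (Suc n0))) (v i - Suc n0)"
      using i(2) by simp
    then show "m \<in> range (s \<circ> (d \<circ> (+) (Suc n0)))"
      by blast
  qed
  moreover have "finite S"
    by (simp add: S_def)
  ultimately have "jointly_large z \<epsilon> S"
    using Qd[of n0] unfolding Q_def by blast
  then obtain f :: "'a \<Rightarrow>\<^sub>L real" where f: "norm f \<le> 1" and fS: "\<And>m. m \<in> S \<Longrightarrow> \<epsilon> < blinfun_apply f (z m)"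
    unfolding jointly_large_def by blast
  have "real n * \<epsilon> = (\<Sum>i=n..<2 * n. \<epsilon>)"
    by simp
  also have "\<dots> \<le> (\<Sum>i=n..<2 * n. blinfun_apply f (w i))"
    by (intro sum_mono less_imp_le) (auto simp: w_def S_def intro: fS)
  also have "\<dots> = blinfun_apply f (\<Sum>i=n..<2 * n. w i)"
    by (simp add: blinfun.sum_right)
  also have "\<dots> \<le> norm (\<Sum>i=n..<2 * n. w i)"
    using abs_blinfun_apply_le[OF f, of "\<Sum>i=n..<2 * n. w i"] by simp
  \<comment> \<open>The block sum is \<open>n\<close> times
    \<open>2 *\<^sub>R M (2 * n) - M n\<close>, whose norm is below
    \<open>3 * \<epsilon> / 4\<close> by the choice of \<open>n0\<close>.\<close>
  also have "(\<Sum>i=n..<2 * n. w i) = (\<Sum>i<2 * n. w i) - (\<Sum>i<n. w i)"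
    by (simp add: lessThan_atLeast0 sum_diff_nat_ivl)
  also have "\<dots> = real (2 * n) *\<^sub>R M (2 * n) - real n *\<^sub>R M n"
    unfolding M_def n_def by (simp only: scaleR_scaleR) simp
  also have "\<dots> = real n *\<^sub>R (2 *\<^sub>R M (2 * n) - M n)"
    by (simp add: scaleR_diff_right mult.commute)
  also have "norm \<dots> = real n * norm (2 *\<^sub>R M (2 * n) - M n)"
    by simp
  finally have "\<epsilon> \<le> norm (2 *\<^sub>R M (2 * n) - M n)"
    by (simp add: n_def)
  also have "\<dots> \<le> 2 * norm (M (2 * n)) + norm (M n)"
    using norm_triangle_ineq4[of "2 *\<^sub>R M (2 * n)" "M n"] by simp
  finally show False
    using n0[of "2 * n"] n0[of n] \<open>0 < \<epsilon>\<close> by (simp add: n_def)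
qed

text \<open>The positions where a functional \<open>f\<close> is large in absolute value are those
  up to \<open>j\<close>, about which the tail says nothing, at most \<open>k\<close> where
  \<open>f\<close> is large and at most \<open>k\<close> where \<open>- f\<close> is large.\<close>

lemma uniformly_weakly_null_set_if_not_jointly_large:
  fixes z :: "nat \<Rightarrow> 'a::real_normed_vector"
  assumes d: "strict_mono d"
    and small: "\<And>j. \<exists>k. \<forall>S. finite S \<longrightarrow> card S = k \<longrightarrow> S \<subseteq> range (d \<circ> (+) (Suc j)) \<longrightarrow>
      \<not> jointly_large z (1 / Suc j) S"
  shows "uniformly_weakly_null_set (range (\<lambda>n. z (d n)))"
  unfolding uniformly_weakly_null_set_def
proof (intro allI impI)
  fix \<epsilon> :: real assume "0 < \<epsilon>"
  then obtain j where j: "1 / Suc j < \<epsilon>"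
    using nat_approx_posE by blast
  obtain k where k: "\<And>S. finite S \<Longrightarrow> card S = k \<Longrightarrow> S \<subseteq> range (d \<circ> (+) (Suc j)) \<Longrightarrow>
      \<not> jointly_large z (1 / Suc j) S"
    using small by blast
  have few: "finite {i. j < i \<and> 1 / Suc j < blinfun_apply f (z (d i))} \<and>
      card {i. j < i \<and> 1 / Suc j < blinfun_apply f (z (d i))} \<le> k"
    if f: "norm f \<le> 1" for f :: "'a \<Rightarrow>\<^sub>L real"
  proof (rule ccontr)
    let ?T = "{i. j < i \<and> 1 / Suc j < blinfun_apply f (z (d i))}"
    assume "\<not> (finite ?T \<and> card ?T \<le> k)"
    then have "infinite ?T \<or> k \<le> card ?T"
      by linarith
    then have "\<exists>T. T \<subseteq> ?T \<and> finite T \<and> card T = k"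
    proof
      assume "infinite ?T"
      then show ?thesis
        using infinite_arbitrarily_large[of ?T k] by blast
    next
      assume "k \<le> card ?T"
      then show ?thesis
        using obtain_subset_with_card_n[of k ?T] by blast
    qed
    then obtain T where T: "T \<subseteq> ?T" "finite T" "card T = k"
      by blast
    have "card (d ` T) = k"
      using T(3) strict_mono_imp_inj_on[OF d] by (metis card_image inj_on_subset subset_UNIV)
    moreover have "d ` T \<subseteq> range (d \<circ> (+) (Suc j))"
    proof
      fix m assume "m \<in> d ` T"
      then obtain i where i: "i \<in> T" "m = d i"
        by blast
      then have "j < i"
        using T(1) by blast
      then have "m = (d \<circ> (+) (Suc j)) (i - Suc j)"
        using i by simp
      then show "m \<in> range (d \<circ> (+) (Suc j))"
        by blast
    qed
    moreover have "jointly_large z (1 / Suc j) (d ` T)"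
      unfolding jointly_large_def using f T(1) by blast
    ultimately show False
      using k T(2) by blast
  qed
  show "\<exists>n. \<forall>f :: 'a \<Rightarrow>\<^sub>L real. norm f \<le> 1 \<longrightarrow>
      finite {x \<in> range (\<lambda>n. z (d n)). \<bar>blinfun_apply f x\<bar> > \<epsilon>} \<and>
      card {x \<in> range (\<lambda>n. z (d n)). \<bar>blinfun_apply f x\<bar> > \<epsilon>} \<le> n"
  proof (intro exI[of _ "Suc j + k + k"] allI impI)
    fix f :: "'a \<Rightarrow>\<^sub>L real" assume f: "norm f \<le> 1"
    define P where "P = {i. j < i \<and> 1 / Suc j < blinfun_apply f (z (d i))}"
    define N where "N = {i. j < i \<and> 1 / Suc j < blinfun_apply (- f) (z (d i))}"
    have P: "finite P" "card P \<le> k"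
      using few[OF f] by (auto simp: P_def)
    have N: "finite N" "card N \<le> k"
      using few[of "- f"] f by (auto simp: N_def)
    define I where "I = {..j} \<union> P \<union> N"
    have "finite I"
      using P N by (simp add: I_def)
    have "card I \<le> card {..j} + card P + card N"
      unfolding I_def by (meson add_le_mono card_Un_le le_refl le_trans)
    then have "card I \<le> Suc j + k + k"
      using P N by simp
    have "i \<in> I" if "\<epsilon> < \<bar>blinfun_apply f (z (d i))\<bar>" for i
    proof (cases "i \<le> j")
      case True
      then show ?thesis by (simp add: I_def)
    next
      case False
      have "1 / Suc j < blinfun_apply f (z (d i)) \<or> 1 / Suc j < - blinfun_apply f (z (d i))"
        using that j by linarith
      with False show ?thesis
        by (auto simp: I_def P_def N_def blinfun.minus_left)
    qed
    then have sub: "{x \<in> range (\<lambda>n. z (d n)). \<bar>blinfun_apply f x\<bar> > \<epsilon>} \<subseteq> (\<lambda>n. z (d n)) ` I"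
      by blast
    have "card ((\<lambda>n. z (d n)) ` I) \<le> Suc j + k + k"
      using card_image_le[OF \<open>finite I\<close>] \<open>card I \<le> Suc j + k + k\<close> by (rule le_trans)
    then show "finite {x \<in> range (\<lambda>n. z (d n)). \<bar>blinfun_apply f x\<bar> > \<epsilon>} \<and>
      card {x \<in> range (\<lambda>n. z (d n)). \<bar>blinfun_apply f x\<bar> > \<epsilon>} \<le> Suc j + k + k"
      using sub \<open>finite I\<close> by (meson card_mono finite_imageI finite_subset le_trans)
  qed
qed

text \<open>The weak limit is the unique Cesaro limit \<open>l\<close>. After subtracting it, every
  subsequence has a further one with means tending to 0, and a diagonal argument over the thresholds
  \<open>1 / Suc j\<close> excludes joint largeness at all of them.\<close>

lemma uniformly_weakly_convergent_subseq_if_Banach_Saks: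
  fixes A :: "'a::real_normed_vector set" and x :: "nat \<Rightarrow> 'a"
  assumes A: "Banach_Saks_set A" and x: "range x \<subseteq> A"
  shows "\<exists>r. strict_mono r \<and> uniformly_weakly_convergent (x \<circ> r)"
proof -
  have Ces: "\<exists>v l. strict_mono (v :: nat \<Rightarrow> nat) \<and> (\<lambda>n. (\<Sum>k<n. x (u (v k))) /\<^sub>R real n) \<longlonglongrightarrow> l"
    for u :: "nat \<Rightarrow> nat"
  proof -
    have "range (x \<circ> u) \<subseteq> A"
      using x by auto
    then obtain v :: "nat \<Rightarrow> nat" where "strict_mono v" "Cesaro_convergent ((x \<circ> u) \<circ> v)"
      using A unfolding Banach_Saks_set_def by blast
    then show ?thesis
      unfolding Cesaro_convergent_def convergent_def o_def by blast
  qed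
  have bdd: "bounded (range x)"
    using Banach_Saks_set_bounded[OF A] x by (rule bounded_subset)
  obtain r :: "nat \<Rightarrow> nat" where r: "strict_mono r"
    and uniq: "\<And>(s :: nat \<Rightarrow> nat) (s' :: nat \<Rightarrow> nat) l l'. strict_mono s \<Longrightarrow> strict_mono s' \<Longrightarrow>
      (\<lambda>n. (\<Sum>k<n. x (r (s k))) /\<^sub>R real n) \<longlonglongrightarrow> l \<Longrightarrow>
      (\<lambda>n. (\<Sum>k<n. x (r (s' k))) /\<^sub>R real n) \<longlonglongrightarrow> l' \<Longrightarrow> l = l'"
    by (rule subseq_unique_Cesaro_limit[OF bdd]) (rule that)
  obtain v0 l where v0: "strict_mono v0" and l: "(\<lambda>n. (\<Sum>k<n. x (r (v0 k))) /\<^sub>R real n) \<longlonglongrightarrow> l"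
    using Ces[of r] by blast
  define z where "z n = x (r n) - l" for n
  have Cz: "\<exists>v :: nat \<Rightarrow> nat. strict_mono v \<and> (\<lambda>n. (\<Sum>k<n. z (u (v k))) /\<^sub>R real n) \<longlonglongrightarrow> 0"
    if u: "strict_mono u" for u :: "nat \<Rightarrow> nat"
  proof -
    obtain v l' where v: "strict_mono (v :: nat \<Rightarrow> nat)"
      and l': "(\<lambda>n. (\<Sum>k<n. x (r (u (v k)))) /\<^sub>R real n) \<longlonglongrightarrow> l'"
      using Ces[of "\<lambda>k. r (u k)"] by blast
    have "l' = l"
      using uniq[OF strict_mono_o[OF u v] v0, of l' l] l l' by (simp add: o_def)
    then have "(\<lambda>n. (\<Sum>k<n. x (r (u (v k))) - l) /\<^sub>R real n) \<longlonglongrightarrow> 0"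
      using l' Cesaro_tendsto_diff_iff[of "\<lambda>k. x (r (u (v k)))" l] by simp
    with v show ?thesis
      unfolding z_def by blast
  qed
  define Q where "Q j s \<longleftrightarrow> (\<exists>k. \<forall>S. finite S \<longrightarrow> card S = k \<longrightarrow> S \<subseteq> range s \<longrightarrow>
      \<not> jointly_large z (1 / Suc j) S)" for j and s :: "nat \<Rightarrow> nat"
  obtain d where d: "strict_mono d" and Qd: "\<And>k. Q k (d \<circ> (+) (Suc k))"
  proof (rule diagonal_subseq[of Q])
    show "\<exists>r. strict_mono r \<and> Q j (s \<circ> r)" if "strict_mono s" for j and s :: "nat \<Rightarrow> nat"
      unfolding Q_def by (rule subseq_not_jointly_large[OF Cz _ that]) simp_all
    show "Q j (s \<circ> r)" if "strict_mono r" "Q j s" for j s and r :: "nat \<Rightarrow> nat"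
    proof -
      have "range (s \<circ> r) \<subseteq> range s" by auto
      with \<open>Q j s\<close> show ?thesis
        unfolding Q_def by (meson subset_trans)
    qed
  qed blast
  have "uniformly_weakly_null_set (range (\<lambda>n. z (d n)))"
    using d Qd unfolding Q_def by (rule uniformly_weakly_null_set_if_not_jointly_large)
  then have "uniformly_weakly_convergent (x \<circ> (r \<circ> d))"
    unfolding uniformly_weakly_convergent_def uniformly_weakly_null_def z_def o_def by blast
  with strict_mono_o[OF r d] show ?thesis
    by blast
qed

section \<open>Bounded ladder length implies the Banach-Saks property\<close>

section \<open>Ladders\<close>

text \<open>A finite form of James's separation condition: for \<open>0 < i < N\<close>, the
  functional \<open>f i\<close> keeps the convex hulls of the terms before \<open>i\<close> and of
  those from \<open>i\<close> on at distance at least \<open>\<theta>\<close>.\<close>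

definition ladder :: "(nat \<Rightarrow> 'a::real_normed_vector) \<Rightarrow> nat \<Rightarrow> real \<Rightarrow> bool" where
  "ladder x N \<theta> \<longleftrightarrow> (\<exists>f :: nat \<Rightarrow> 'a \<Rightarrow>\<^sub>L real. (\<forall>i. norm (f i) \<le> 1) \<and>
     (\<forall>i j j'. j < i \<longrightarrow> i \<le> j' \<longrightarrow> j' < N \<longrightarrow>
        \<theta> \<le> blinfun_apply (f i) (x j) - blinfun_apply (f i) (x j')))"

text \<open>A property of an index set with a threshold \<open>a\<close>, rather than of a tuple, so
  that Ramsey's theorem applies. In a set of \<open>2 * k\<close> indices the threshold cuts in the
  middle.\<close>

definition half_separated :: "(nat \<Rightarrow> 'a::real_normed_vector) \<Rightarrow> nat \<Rightarrow> real \<Rightarrow> nat set \<Rightarrow> bool" where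
  "half_separated y k \<theta> S \<longleftrightarrow> (\<exists>(f :: 'a \<Rightarrow>\<^sub>L real) a. norm f \<le> 1 \<and> card {n \<in> S. n < a} = k \<and>
     (\<forall>n\<in>S. \<forall>m\<in>S. n < a \<longrightarrow> a \<le> m \<longrightarrow> \<theta> \<le> blinfun_apply f (y n) - blinfun_apply f (y m)))"

text \<open>Slide a window of length \<open>2 * k\<close>. For \<open>0 < i < k\<close> the window
  starting at \<open>i\<close> contains all positions \<open>k + j\<close> with
  \<open>j < k\<close>, and its midpoint \<open>i + k\<close> separates those with
  \<open>j < i\<close> from those with \<open>j \<ge> i\<close>.\<close>

lemma ladder_if_half_separated:
  fixes y :: "nat \<Rightarrow> 'a::real_normed_vector" and s :: "nat \<Rightarrow> nat"
  assumes s: "strict_mono s"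
    and sep: "\<And>S. finite S \<Longrightarrow> card S = 2 * k \<Longrightarrow> S \<subseteq> range s \<Longrightarrow> half_separated y k \<theta> S"
  shows "ladder (\<lambda>j. y (s (k + j))) k \<theta>"
proof -
  have "\<exists>f :: 'a \<Rightarrow>\<^sub>L real. norm f \<le> 1 \<and> (\<forall>j j'. i \<le> j \<longrightarrow> j < i + k \<longrightarrow> i + k \<le> j' \<longrightarrow> j' < i + 2 * k \<longrightarrow>
      \<theta> \<le> blinfun_apply f (y (s j)) - blinfun_apply f (y (s j')))" for i
  proof -
    define S where "S = s ` {i..<i + 2 * k}"
    have inj: "inj_on s T" for T
      by (rule strict_mono_imp_inj_on[OF s])
    have "half_separated y k \<theta> S"
      by (rule sep) (auto simp: S_def card_image[OF inj])
    then obtain f :: "'a \<Rightarrow>\<^sub>L real" and a where f: "norm f \<le> 1" and a: "card {n \<in> S. n < a} = k"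
      and fS: "\<And>n m. n \<in> S \<Longrightarrow> m \<in> S \<Longrightarrow> n < a \<Longrightarrow> a \<le> m \<Longrightarrow>
        \<theta> \<le> blinfun_apply f (y n) - blinfun_apply f (y m)"
      unfolding half_separated_def by blast
    \<comment> \<open>As \<open>s\<close> increases, \<open>D\<close> is an initial segment of the
      window; having \<open>k\<close> elements, it is the first half.\<close>
    define D where "D = {j \<in> {i..<i + 2 * k}. s j < a}"
    have "{n \<in> S. n < a} = s ` D"
      by (auto simp: S_def D_def)
    then have cD: "card D = k"
      using a card_image[OF inj] by metis
    have "finite D"
      by (simp add: D_def)
    have "D \<subseteq> {i..<i + k}"
    proof
      fix j assume j: "j \<in> D"
      have "s j'' \<le> s j" if "j'' \<le> j" for j''
        using strict_mono_less_eq[OF s] that by simp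
      then have "{i..j} \<subseteq> D"
        using j unfolding D_def by force
      from card_mono[OF \<open>finite D\<close> this] have "Suc j - i \<le> k"
        using cD by simp
      moreover have "i \<le> j"
        using j by (simp add: D_def)
      ultimately show "j \<in> {i..<i + k}"
        by simp
    qed
    moreover have "card D = card {i..<i + k}"
      using cD by simp
    ultimately have D: "D = {i..<i + k}"
      by (intro card_subset_eq) simp_all
    show ?thesis
    proof (intro exI[of _ f] conjI f allI impI)
      fix j j' assume j: "i \<le> j" "j < i + k" and j': "i + k \<le> j'" "j' < i + 2 * k"
      have "j \<in> D" "j' \<notin> D"
        using j j' D by auto
      then have "s j < a" "a \<le> s j'"
        using j' by (auto simp: D_def)
      moreover have "s j \<in> S" "s j' \<in> S"
        using j j' by (auto simp: S_def)
      ultimately show "\<theta> \<le> blinfun_apply f (y (s j)) - blinfun_apply f (y (s j'))"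
        by (intro fS)
    qed
  qed
  then obtain f :: "nat \<Rightarrow> 'a \<Rightarrow>\<^sub>L real" where f: "\<And>i. norm (f i) \<le> 1"
    and fy: "\<And>i j j'. i \<le> j \<Longrightarrow> j < i + k \<Longrightarrow> i + k \<le> j' \<Longrightarrow> j' < i + 2 * k \<Longrightarrow>
      \<theta> \<le> blinfun_apply (f i) (y (s j)) - blinfun_apply (f i) (y (s j'))"
    by metis
  show ?thesis
    unfolding ladder_def by (intro exI[of _ f] conjI allI impI f fy) simp_all
qed

text \<open>The bound is uniform in the block length \<open>n\<close>, the positions
  \<open>p\<close> and \<open>q\<close>, and the functional: \<open>B\<close> depends only on
  \<open>C\<close> and \<open>\<epsilon>\<close> and contains the number of every cell that a value
  of \<open>f\<close> can fall in. The condition \<open>p + n \<le> q\<close> puts every chosen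
  index of the first block before every one of the second.\<close>

lemma few_drops_if_not_half_separated:
  fixes y :: "nat \<Rightarrow> 'a::real_normed_vector" and s :: "nat \<Rightarrow> nat"
  assumes s: "strict_mono s" and C: "\<And>n. norm (y n) \<le> C" and "0 < \<epsilon>"
    and nsep: "\<And>S. finite S \<Longrightarrow> card S = 2 * k \<Longrightarrow> S \<subseteq> range s \<Longrightarrow> \<not> half_separated y k (\<epsilon> / 2) S"
  shows "\<exists>K. \<forall>n p q. \<forall>f :: 'a \<Rightarrow>\<^sub>L real. p + n \<le> q \<longrightarrow> norm f \<le> 1 \<longrightarrow>
    card {i. i < n \<and> \<epsilon> < blinfun_apply f (y (s (p + i))) - blinfun_apply f (y (s (q + i)))} \<le> K"
proof -
  define R where "R = \<lceil>2 * C / \<epsilon>\<rceil> + 1"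
  define B where "B = {- R..R}"
  have "0 \<le> C"
    using C[of 0] norm_ge_zero order_trans by blast
  then have "0 \<le> 2 * C / \<epsilon>"
    using \<open>0 < \<epsilon>\<close> by simp
  then have "0 \<le> R"
    unfolding R_def by linarith
  then have B: "finite B" "B \<noteq> {}"
    by (auto simp: B_def)
  show ?thesis
  proof (intro exI[of _ "k * card B"] allI impI)
    fix n p q :: nat and f :: "'a \<Rightarrow>\<^sub>L real"
    assume pq: "p + n \<le> q" and f: "norm f \<le> 1"
    define T where "T = {i. i < n \<and> \<epsilon> < blinfun_apply f (y (s (p + i))) - blinfun_apply f (y (s (q + i)))}"
    text \<open>Among many drops, \<open>k\<close> start in the same cell of length \<open>\<epsilon> / 2\<close>, so a drop by \<open>\<epsilon>\<close> at
      equal indices becomes a gap of \<open>\<epsilon> / 2\<close> between all of the chosen indices.\<close>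
    define c where "c i = \<lfloor>blinfun_apply f (y (s (p + i))) / (\<epsilon> / 2)\<rfloor>" for i
    have cell: "of_int (c i) * (\<epsilon> / 2) \<le> blinfun_apply f (y (s (p + i)))"
      "blinfun_apply f (y (s (p + i))) < (of_int (c i) + 1) * (\<epsilon> / 2)" for i
      using floor_divide_lower[of "\<epsilon> / 2" "blinfun_apply f (y (s (p + i)))"]
        floor_divide_upper[of "\<epsilon> / 2" "blinfun_apply f (y (s (p + i)))"] \<open>0 < \<epsilon>\<close>
      by (auto simp: c_def)
    have "card T \<le> k * card B"
    proof (rule ccontr)
      assume "\<not> card T \<le> k * card B"
      have "finite T"
        by (simp add: T_def)
      have "c i \<in> B" for i
      proof -
        have "\<bar>blinfun_apply f (y (s (p + i)))\<bar> \<le> C"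
          using abs_blinfun_apply_le[OF f] C by (rule order_trans)
        then have "\<bar>blinfun_apply f (y (s (p + i)))\<bar> / (\<epsilon> / 2) \<le> C / (\<epsilon> / 2)"
          using \<open>0 < \<epsilon>\<close> by (intro divide_right_mono) simp_all
        then have "\<bar>blinfun_apply f (y (s (p + i))) / (\<epsilon> / 2)\<bar> \<le> 2 * C / \<epsilon>"
          using \<open>0 < \<epsilon>\<close> by (simp add: mult.commute)
        then have "- R \<le> c i" "c i \<le> R"
          unfolding c_def R_def by linarith+
        then show ?thesis
          by (simp add: B_def)
      qed
      then have "c \<in> T \<rightarrow> B"
        by simp
      from pigeonhole_card[OF this \<open>finite T\<close> B] obtain b where
        "card T \<le> card (c -` {b} \<inter> T) * card B"
        by blast
      then have "k * card B < card (c -` {b} \<inter> T) * card B"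
        using \<open>\<not> card T \<le> k * card B\<close> by linarith
      then have "k \<le> card (c -` {b} \<inter> T)"
        by simp
      then obtain G where G: "G \<subseteq> c -` {b} \<inter> T" "card G = k" "finite G"
        by (rule obtain_subset_with_card_n)
      have inj: "inj_on (\<lambda>i. s (m + i)) G" for m
        using strict_mono_eq[OF s] by (auto intro: inj_onI)
      define S1 where "S1 = (\<lambda>i. s (p + i)) ` G"
      define S2 where "S2 = (\<lambda>i. s (q + i)) ` G"
      have lt: "p + i < q" if "i \<in> G" for i
        using that G(1) pq by (auto simp: T_def)
      have S1: "v < s q" if "v \<in> S1" for v
        using that lt strict_mono_less[OF s] by (auto simp: S1_def)
      have S2: "s q \<le> v" if "v \<in> S2" for v
        using that strict_mono_less_eq[OF s] by (auto simp: S2_def)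
      have "S1 \<inter> S2 = {}"
        using S1 S2 by fastforce
      moreover have "card S1 = k" "card S2 = k" "finite S1" "finite S2"
        using G by (auto simp: S1_def S2_def card_image[OF inj])
      ultimately have "card (S1 \<union> S2) = 2 * k"
        by (simp add: card_Un_disjoint)
      moreover have "finite (S1 \<union> S2)"
        using \<open>finite S1\<close> \<open>finite S2\<close> by simp
      moreover have "S1 \<union> S2 \<subseteq> range s"
        by (auto simp: S1_def S2_def)
      moreover have "half_separated y k (\<epsilon> / 2) (S1 \<union> S2)"
        unfolding half_separated_def
      proof (intro exI[of _ f] exI[of _ "s q"] conjI f ballI impI)
        have "{v \<in> S1 \<union> S2. v < s q} = S1"
          using S1 S2 by fastforce
        then show "card {v \<in> S1 \<union> S2. v < s q} = k"
          using \<open>card S1 = k\<close> by simp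
        fix v w assume vw: "v \<in> S1 \<union> S2" "w \<in> S1 \<union> S2" "v < s q" "s q \<le> w"
        then have "v \<in> S1" "w \<in> S2"
          using S1 S2 by fastforce+
        then obtain i j where i: "i \<in> G" "v = s (p + i)" and j: "j \<in> G" "w = s (q + j)"
          by (auto simp: S1_def S2_def)
        have "c i = b" "c j = b" "\<epsilon> < blinfun_apply f (y (s (p + j))) - blinfun_apply f (y (s (q + j)))"
          using G(1) i(1) j(1) by (auto simp: T_def)
        then show "\<epsilon> / 2 \<le> blinfun_apply f (y v) - blinfun_apply f (y w)"
          using cell(1)[of i] cell(2)[of j] i(2) j(2) by (simp add: algebra_simps)
      qed
      ultimately show False
        using nsep by blast
    qed
    then show "card {i. i < n \<and> \<epsilon> < blinfun_apply f (y (s (p + i))) - blinfun_apply f (y (s (q + i)))} \<le> k * card B"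
      by (simp add: T_def)
  qed
qed

text \<open>Up to a bounded initial remainder, a long sum splits into blocks of length
  \<open>n\<close>, each close to \<open>n\<close> times \<open>v\<close>. Hence late means are
  close to \<open>v\<close>. Since \<open>v\<close> varies with \<open>\<epsilon>\<close>, this
  shows only that the means are Cauchy, and completeness supplies the limit.\<close>

lemma Cesaro_convergent_if_blocks:
  fixes w :: "nat \<Rightarrow> 'a::banach"
  assumes blocks: "\<And>\<epsilon>. 0 < \<epsilon> \<Longrightarrow>
    \<exists>n v P. 0 < n \<and> (\<forall>q\<ge>P. norm ((\<Sum>i<n. w (q + i)) - real n *\<^sub>R v) \<le> real n * \<epsilon>)"
  shows "Cesaro_convergent w"
proof -
  define M where "M N = (\<Sum>i<N. w i) /\<^sub>R real N" for N
  have "Cauchy M"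
  proof (rule CauchyI)
    fix e :: real assume "0 < e"
    \<comment> \<open>One \<open>\<epsilon>\<close> is for the remainder \<open>B\<close> divided by
      \<open>N\<close> and one for the blocks, which puts late means within \<open>e / 2\<close> of
      \<open>v\<close>.\<close>
    define \<epsilon> where "\<epsilon> = e / 4"
    have "0 < \<epsilon>"
      using \<open>0 < e\<close> by (simp add: \<epsilon>_def)
    from blocks[OF this] obtain n v P where "0 < n"
      and nv: "\<And>q. q \<ge> P \<Longrightarrow> norm ((\<Sum>i<n. w (q + i)) - real n *\<^sub>R v) \<le> real n * \<epsilon>"
      by blast
    define B where "B = (\<Sum>i<P + n. norm (w i - v))"
    have bound: "norm (\<Sum>i<N. w i - v) \<le> B + real N * \<epsilon>" for N
    proof (induction N rule: less_induct)
      case (less N)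
      show ?case
      proof (cases "N < P + n")
        case True
        have "norm (\<Sum>i<N. w i - v) \<le> (\<Sum>i<N. norm (w i - v))"
          by (rule norm_sum)
        also have "\<dots> \<le> B"
          unfolding B_def using True by (intro sum_mono2) auto
        finally show ?thesis
          using \<open>0 < \<epsilon>\<close> by (simp add: add_increasing2)
      next
        case False
        \<comment> \<open>The induction removes the last block; from \<open>N \<ge> P + n\<close> it
          starts at \<open>q \<ge> P\<close>, where the hypothesis applies.\<close>
        define q where "q = N - n"
        have q: "N = q + n" "P \<le> q" "q < N"
          using False \<open>0 < n\<close> by (auto simp: q_def)
        have "(\<Sum>i<N. w i - v) = (\<Sum>i<q. w i - v) + (\<Sum>i<n. w (q + i) - v)"
          unfolding q(1) by (induction n) (simp_all add: add.assoc)
        also have "norm \<dots> \<le> norm (\<Sum>i<q. w i - v) + norm (\<Sum>i<n. w (q + i) - v)"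
          by (rule norm_triangle_ineq)
        also have "\<dots> \<le> (B + real q * \<epsilon>) + real n * \<epsilon>"
          using less.IH[OF q(3)] nv[OF q(2)] by (intro add_mono) (simp_all add: sum_subtractf sum_constant_scaleR)
        also have "\<dots> = B + real N * \<epsilon>"
          by (simp add: q(1) algebra_simps)
        finally show ?thesis .
      qed
    qed
    obtain N0 :: nat where N0: "B / \<epsilon> < real N0"
      using reals_Archimedean2 by blast
    have "0 \<le> B"
      unfolding B_def by (intro sum_nonneg) simp
    have close: "norm (M N - v) < e / 2" if "N \<ge> N0" for N
    proof -
      have "B / \<epsilon> < real N"
        using N0 that by simp
      moreover have "0 \<le> B / \<epsilon>"
        using \<open>0 \<le> B\<close> \<open>0 < \<epsilon>\<close> by simp
      ultimately have "0 < real N"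
        by simp
      have "M N - v = (\<Sum>i<N. w i - v) /\<^sub>R real N"
        unfolding M_def using \<open>0 < real N\<close> by (intro Cesaro_mean_diff[symmetric]) simp
      then have "norm (M N - v) = norm (\<Sum>i<N. w i - v) / real N"
        by (simp add: divide_inverse mult.commute)
      also have "\<dots> < e / 2"
        using bound[of N] \<open>B / \<epsilon> < real N\<close> \<open>0 < real N\<close> \<open>0 < \<epsilon>\<close> by (simp add: field_simps \<epsilon>_def)
      finally show ?thesis .
    qed
    have "norm (M m - M n) < e" if "m \<ge> N0" "n \<ge> N0" for m n
      using close[OF that(1)] close[OF that(2)] norm_triangle_ineq4[of "M m - v" "M n - v"] by simp
    then show "\<exists>N0. \<forall>m\<ge>N0. \<forall>n\<ge>N0. norm (M m - M n) < e"
      by blast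
  qed
  then have "convergent M"
    by (rule Cauchy_convergent)
  then show ?thesis
    by (simp add: Cesaro_convergent_def M_def[abs_def])
qed

text \<open>Half-separation of all \<open>2 * k\<close>-sets would build a ladder of the excluded
  length \<open>k\<close>, so Ramsey's theorem gives the opposite alternative. Then two disjoint
  blocks differ noticeably under a functional in at most \<open>K\<close> places, so their averages
  are close once the blocks are long.\<close>

lemma Banach_Saks_set_if_no_ladders:
  fixes A :: "'a::banach set"
  assumes bdd: "bounded A"
    and no_ladder: "\<And>\<theta>. 0 < \<theta> \<Longrightarrow> \<exists>N. \<forall>x. x ` {..<N} \<subseteq> A \<longrightarrow> \<not> ladder x N \<theta>"
  shows "Banach_Saks_set A"
  unfolding Banach_Saks_set_def
proof (intro allI impI)
  fix y :: "nat \<Rightarrow> 'a" assume y: "range y \<subseteq> A"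
  have "bounded (range y)"
    using bdd y by (rule bounded_subset)
  then obtain C where C: "\<And>n. norm (y n) \<le> C"
    by (auto simp: bounded_iff)
  then have "0 \<le> C"
    using norm_ge_zero order_trans by blast
  define Q where "Q j s \<longleftrightarrow> (\<exists>k. \<forall>S. finite S \<longrightarrow> card S = 2 * k \<longrightarrow> S \<subseteq> range s \<longrightarrow>
      \<not> half_separated y k (1 / Suc j / 2) S)" for j and s :: "nat \<Rightarrow> nat"
  obtain d where d: "strict_mono d" and Qd: "\<And>k. Q k (d \<circ> (+) (Suc k))"
  proof (rule diagonal_subseq[of Q])
    show "\<exists>r. strict_mono r \<and> Q j (s \<circ> r)" if s: "strict_mono s" for j and s :: "nat \<Rightarrow> nat"
    proof -
      have "0 < 1 / real (Suc j) / 2"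
        by simp
      from no_ladder[OF this] obtain k where k: "\<And>x. x ` {..<k} \<subseteq> A \<Longrightarrow> \<not> ladder x k (1 / Suc j / 2)"
        by blast
      obtain r :: "nat \<Rightarrow> nat" where r: "strict_mono r" and
        alt: "(\<forall>S. finite S \<longrightarrow> card S = 2 * k \<longrightarrow> S \<subseteq> range (s \<circ> r) \<longrightarrow> half_separated y k (1 / Suc j / 2) S) \<or>
         (\<forall>S. finite S \<longrightarrow> card S = 2 * k \<longrightarrow> S \<subseteq> range (s \<circ> r) \<longrightarrow> \<not> half_separated y k (1 / Suc j / 2) S)"
        by (rule Ramsey_subseq[OF s, of "2 * k" "half_separated y k (1 / Suc j / 2)"]) (rule that)
      have "\<not> ladder (\<lambda>i. y ((s \<circ> r) (k + i))) k (1 / Suc j / 2)"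
        using y by (intro k) auto
      then have "\<not> (\<forall>S. finite S \<longrightarrow> card S = 2 * k \<longrightarrow> S \<subseteq> range (s \<circ> r) \<longrightarrow> half_separated y k (1 / Suc j / 2) S)"
        using ladder_if_half_separated[OF strict_mono_o[OF s r], of k y] by blast
      with alt have "Q j (s \<circ> r)"
        unfolding Q_def by blast
      with r show ?thesis by blast
    qed
    show "Q j (s \<circ> r)" if "strict_mono r" "Q j s" for j s and r :: "nat \<Rightarrow> nat"
    proof -
      have "range (s \<circ> r) \<subseteq> range s" by auto
      with \<open>Q j s\<close> show ?thesis
        unfolding Q_def by (meson subset_trans)
    qed
  qed blast
  have "Cesaro_convergent (y \<circ> d)"
  proof (rule Cesaro_convergent_if_blocks)
    fix \<epsilon> :: real assume "0 < \<epsilon>"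
    then have "0 < \<epsilon> / 2"
      by simp
    then obtain j where j: "1 / Suc j < \<epsilon> / 2"
      by (rule nat_approx_posE)
    define s where "s = d \<circ> (+) (Suc j)"
    have s: "strict_mono s"
      using d by (simp add: s_def strict_mono_def)
    obtain k where k: "\<And>S. finite S \<Longrightarrow> card S = 2 * k \<Longrightarrow> S \<subseteq> range s \<Longrightarrow>
        \<not> half_separated y k (1 / Suc j / 2) S"
      using Qd[of j] unfolding Q_def s_def by blast
    have "\<exists>K. \<forall>n p q. \<forall>f :: 'a \<Rightarrow>\<^sub>L real. p + n \<le> q \<longrightarrow> norm f \<le> 1 \<longrightarrow>
        card {i. i < n \<and> 1 / Suc j < blinfun_apply f (y (s (p + i))) - blinfun_apply f (y (s (q + i)))} \<le> K"
    proof (rule few_drops_if_not_half_separated[OF s C])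
      show "0 < 1 / real (Suc j)"
        by simp
      show "\<not> half_separated y k (1 / Suc j / 2) S" if "finite S" "card S = 2 * k" "S \<subseteq> range s" for S
        using that by (rule k)
    qed
    then obtain K where K: "\<And>n p q (f :: 'a \<Rightarrow>\<^sub>L real). p + n \<le> q \<Longrightarrow> norm f \<le> 1 \<Longrightarrow>
        card {i. i < n \<and> 1 / Suc j < blinfun_apply f (y (s (p + i))) - blinfun_apply f (y (s (q + i)))} \<le> K"
      by blast
    have block: "norm ((\<Sum>i<n. y (s (p + i))) - (\<Sum>i<n. y (s (q + i)))) \<le> real n * (\<epsilon> / 2) + real K * (2 * C)"
      if "p + n \<le> q" for n p q
    proof (rule norm_le_dual)
      fix f :: "'a \<Rightarrow>\<^sub>L real" assume f: "norm f \<le> 1"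
      define D where "D i = blinfun_apply f (y (s (p + i))) - blinfun_apply f (y (s (q + i)))" for i
      have D: "D i \<le> 2 * C" for i
        using abs_blinfun_apply_le[OF f, of "y (s (p + i))"] abs_blinfun_apply_le[OF f, of "y (s (q + i))"]
          C[of "s (p + i)"] C[of "s (q + i)"] by (simp add: D_def)
      have Dle: "D i \<le> \<epsilon> / 2 + (if 1 / Suc j < D i then 2 * C else 0)" for i
        using D[of i] j \<open>0 < \<epsilon>\<close> by auto
      have "blinfun_apply f ((\<Sum>i<n. y (s (p + i))) - (\<Sum>i<n. y (s (q + i)))) = (\<Sum>i<n. D i)"
        by (simp add: D_def blinfun.diff_right blinfun.sum_right sum_subtractf)
      also have "\<dots> \<le> (\<Sum>i<n. \<epsilon> / 2 + (if 1 / Suc j < D i then 2 * C else 0))"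
        by (intro sum_mono Dle)
      also have "\<dots> = real n * (\<epsilon> / 2) + real (card {i. i < n \<and> 1 / Suc j < D i}) * (2 * C)"
        by (simp add: sum.distrib flip: sum.inter_filter)
      also have "\<dots> \<le> real n * (\<epsilon> / 2) + real K * (2 * C)"
        using K[OF that f] \<open>0 \<le> C\<close> unfolding D_def by (intro add_left_mono mult_right_mono) simp_all
      finally show "blinfun_apply f ((\<Sum>i<n. y (s (p + i))) - (\<Sum>i<n. y (s (q + i)))) \<le>
        real n * (\<epsilon> / 2) + real K * (2 * C)" .
    qed
    obtain n0 :: nat where n0: "2 * (real K * (2 * C)) / \<epsilon> < real n0"
      using reals_Archimedean2 by blast
    \<comment> \<open>The block is long enough for the \<open>K\<close> exceptional places to cost
      at most \<open>n * (\<epsilon> / 2)\<close>; \<open>Suc\<close> makes its length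
      positive.\<close>
    define n where "n = Suc n0"
    have n: "real K * (2 * C) \<le> real n * (\<epsilon> / 2)"
      using n0 \<open>0 < \<epsilon>\<close> by (simp add: n_def field_simps)
    define v where "v = (\<Sum>i<n. y (s i)) /\<^sub>R real n"
    \<comment> \<open>All later blocks are compared with the first block of \<open>s\<close>: the
      shift \<open>Suc j\<close> passes from \<open>d\<close> to \<open>s\<close>, and the
      additional \<open>n\<close> makes the blocks disjoint.\<close>
    have "norm ((\<Sum>i<n. (y \<circ> d) (q + i)) - real n *\<^sub>R v) \<le> real n * \<epsilon>" if "q \<ge> Suc j + n" for q
    proof -
      have q: "d (q + i) = s (q - Suc j + i)" for i
        using that by (simp add: s_def)
      have "real n *\<^sub>R v = (\<Sum>i<n. y (s (0 + i)))"
        by (simp add: v_def n_def)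
      then have "norm ((\<Sum>i<n. (y \<circ> d) (q + i)) - real n *\<^sub>R v) =
          norm ((\<Sum>i<n. y (s (0 + i))) - (\<Sum>i<n. y (s (q - Suc j + i))))"
        by (simp add: q norm_minus_commute)
      also have "\<dots> \<le> real n * (\<epsilon> / 2) + real K * (2 * C)"
        using that by (intro block) simp
      also have "\<dots> \<le> real n * \<epsilon>"
        using n by (simp add: field_simps)
      finally show ?thesis .
    qed
    then show "\<exists>n v P. 0 < n \<and> (\<forall>q\<ge>P. norm ((\<Sum>i<n. (y \<circ> d) (q + i)) - real n *\<^sub>R v) \<le> real n * \<epsilon>)"
      by (intro exI[of _ n] exI[of _ v] exI[of _ "Suc j + n"]) (simp add: n_def)
  qed
  with d show "\<exists>r. strict_mono r \<and> Cesaro_convergent (y \<circ> r)"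
    by blast
qed

section \<open>Weak cluster points and the double limit argument in the ultrapower\<close>

section \<open>Ultrapowers\<close>

text \<open>Compactness of the interval gives a cluster point along the filter, and for an
  ultrafilter every cluster point is a limit.\<close>

lemma free_ultrafilter_convergent:
  fixes a :: "nat \<Rightarrow> real"
  assumes \<U>: "free_ultrafilter \<U>" and C: "\<And>n. \<bar>a n\<bar> \<le> C"
  shows "(a \<longlongrightarrow> Lim \<U> a) \<U>"
proof -
  have "\<U> \<noteq> bot"
    using \<U> by (simp add: free_ultrafilter_def)
  have "compact {- C..C}" "filtermap a \<U> \<noteq> bot" "eventually (\<lambda>x. x \<in> {- C..C}) (filtermap a \<U>)"
    using C \<open>\<U> \<noteq> bot\<close> by (auto simp: filtermap_bot_iff eventually_filtermap abs_le_iff minus_le_iff)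
  then obtain L where L: "inf (nhds L) (filtermap a \<U>) \<noteq> bot"
    unfolding compact_filter by blast
  have "eventually (\<lambda>n. P (a n)) \<U>" if P: "eventually P (nhds L)" for P
  proof (rule ccontr)
    assume "\<not> eventually (\<lambda>n. P (a n)) \<U>"
    then have "eventually (\<lambda>n. \<not> P (a n)) \<U>"
      using \<U> unfolding free_ultrafilter_def by blast
    then have "eventually (\<lambda>x. \<not> P x) (filtermap a \<U>)"
      by (simp add: eventually_filtermap)
    with P have "eventually (\<lambda>x. False) (inf (nhds L) (filtermap a \<U>))"
      unfolding eventually_inf by blast
    with L show False
      by (simp add: trivial_limit_def)
  qed
  then have "(a \<longlongrightarrow> L) \<U>"
    by (simp add: filterlim_iff)
  moreover from this have "Lim \<U> a = L"
    using \<open>\<U> \<noteq> bot\<close> by (intro tendsto_Lim)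
  ultimately show ?thesis
    by simp
qed

text \<open>\<open>L\<close> is constant on cosets, so it may be evaluated at a chosen
  representative, and its bound at every representative passes to the infimum. This turns
  ultrafilter limits into functionals on the ultrapower.\<close>

lemma quotient_dual_lift:
  fixes L :: "'b::real_normed_vector \<Rightarrow> real"
  assumes add: "\<And>x y. L (x + y) = L x + L y" and scale: "\<And>c x. L (c *\<^sub>R x) = c * L x"
    and bound: "\<And>x. \<bar>L x\<bar> \<le> norm x" and "0 \<in> N" and null: "\<And>x. x \<in> N \<Longrightarrow> L x = 0"
  obtains \<phi> where "\<phi> \<in> quotient_dual N" "\<And>x. \<phi> (coset N x) = L x"
proof -
  define \<phi> where "\<phi> C = L (SOME y. y \<in> C)" for C
  have L: "L y = L x" if "y \<in> coset N x" for x y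
    using that add null by (auto simp: coset_def)
  have ne: "x \<in> coset N x" for x
    unfolding coset_def using \<open>0 \<in> N\<close> by (metis add.right_neutral image_eqI)
  have \<phi>: "\<phi> (coset N x) = L x" for x
    unfolding \<phi>_def by (rule L) (rule someI[of _ x], rule ne)
  have "\<bar>\<phi> C\<bar> \<le> 1 * quotient_norm C" if C': "C \<in> quotient_space N" for C
  proof -
    obtain x where C: "C = coset N x"
      using C' unfolding quotient_space_def by blast
    have "\<bar>L x\<bar> \<le> norm y" if "y \<in> C" for y
      using bound[of y] L[of y x] that C by simp
    then have "\<bar>L x\<bar> \<le> (INF y\<in>C. norm y)"
      using ne[of x] unfolding C by (intro cINF_greatest) auto
    then show ?thesis
      by (simp add: quotient_norm_def C \<phi>)
  qed
  then have "\<phi> \<in> quotient_dual N"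
    unfolding quotient_dual_def using add scale by (auto simp: \<phi> intro: exI[of _ 1])
  with \<phi> show ?thesis
    using that by blast
qed

text \<open>Otherwise the open sets visited only finitely often cover \<open>K\<close>, and a finite
  subcover leaves room for only finitely many indices.\<close>

lemma compactin_cluster_point:
  fixes \<xi> :: "nat \<Rightarrow> 'b"
  assumes K: "compactin T K" and \<xi>: "\<And>j. \<xi> j \<in> K"
  obtains C where "C \<in> K" "\<And>W. openin T W \<Longrightarrow> C \<in> W \<Longrightarrow> infinite {j. \<xi> j \<in> W}"
proof (rule ccontr)
  assume contra: "\<not> thesis"
  define \<W> where "\<W> = {W. openin T W \<and> finite {j. \<xi> j \<in> W}}"
  have "K \<subseteq> \<Union>\<W>"
    using contra that unfolding \<W>_def by blast
  then obtain \<F> where \<F>: "finite \<F>" "\<F> \<subseteq> \<W>" "K \<subseteq> \<Union>\<F>"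
    using compactinD[OF K, of \<W>] unfolding \<W>_def by blast
  then have "finite (\<Union>W\<in>\<F>. {j. \<xi> j \<in> W})"
    unfolding \<W>_def by blast
  moreover have "(\<Union>W\<in>\<F>. {j. \<xi> j \<in> W}) = UNIV"
    using \<F>(3) \<xi> by blast
  ultimately show False
    by simp
qed

text \<open>Infinitely many indices are recorded because the double limit argument picks one beyond
  a given bound.\<close>

lemma quotient_weak_cluster_point:
  fixes z :: "nat \<Rightarrow> 'b::real_normed_vector"
  assumes K: "compactin (quotient_weak_topology N) K" and z: "\<And>j. coset N (z j) \<in> K"
  obtains w where "\<And>\<phi> \<delta>. \<phi> \<in> quotient_dual N \<Longrightarrow> 0 < \<delta> \<Longrightarrow>
    infinite {j. \<bar>\<phi> (coset N (z j)) - \<phi> (coset N w)\<bar> < \<delta>}"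
proof -
  obtain C where "C \<in> K"
    and C: "\<And>W. openin (quotient_weak_topology N) W \<Longrightarrow> C \<in> W \<Longrightarrow> infinite {j. coset N (z j) \<in> W}"
    using K z by (rule compactin_cluster_point[of _ _ "\<lambda>j. coset N (z j)"]) (rule that)
  have "C \<in> quotient_space N"
    using compactin_subset_topspace[OF K] \<open>C \<in> K\<close> by auto
  then obtain w where w: "C = coset N w"
    unfolding quotient_space_def by blast
  have "infinite {j. \<bar>\<phi> (coset N (z j)) - \<phi> (coset N w)\<bar> < \<delta>}"
    if \<phi>: "\<phi> \<in> quotient_dual N" and "0 < \<delta>" for \<phi> \<delta>
  proof -
    define W where "W = {C \<in> quotient_space N. \<phi> C \<in> ball (\<phi> (coset N w)) \<delta>}"
    have "openin (quotient_weak_topology N) W"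
      unfolding quotient_weak_topology_def W_def
      by (rule topology_generated_by_Basis) (use \<phi> open_ball in blast)
    moreover have "C \<in> W"
      using \<open>0 < \<delta>\<close> \<open>C \<in> quotient_space N\<close> w by (simp add: W_def)
    ultimately have "infinite {j. coset N (z j) \<in> W}"
      by (rule C)
    moreover have "{j. coset N (z j) \<in> W} \<subseteq> {j. \<bar>\<phi> (coset N (z j)) - \<phi> (coset N w)\<bar> < \<delta>}"
      by (auto simp: W_def dist_real_def abs_minus_commute)
    ultimately show ?thesis
      using finite_subset by blast
  qed
  then show ?thesis
    by (rule that)
qed

text \<open>Ladders of every length assemble into an infinite ladder \<open>z\<close> in the
  ultrapower, with functionals \<open>\<Lambda> i\<close>. A weak cluster point \<open>w\<close> of
  \<open>z\<close> stays \<open>\<theta>\<close> below each \<open>z j\<close> under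
  \<open>\<Lambda> i\<close> for \<open>i > j\<close>, hence under their limit
  \<open>\<Lambda>'\<close> for all \<open>j\<close>. This contradicts the choice of
  \<open>w\<close>.\<close>

lemma no_long_ladders_if_relatively_super_weakly_compact:
  fixes A :: "'a::real_normed_vector set"
  assumes A: "relatively_super_weakly_compact A" and "0 < \<theta>"
  shows "\<exists>N. \<forall>x. x ` {..<N} \<subseteq> A \<longrightarrow> \<not> ladder x N \<theta>"
proof (rule ccontr)
  assume contra: "\<not> ?thesis"
  obtain \<U> where "bounded A" and \<U>: "free_ultrafilter \<U>" and
    K: "compactin (quotient_weak_topology (ultra_null_sequences \<U>))
      (quotient_weak_topology (ultra_null_sequences \<U>) closure_of ultrapower_set \<U> A)"
    using A unfolding relatively_super_weakly_compact_def Let_def by blast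
  define Z where "Z = (ultra_null_sequences \<U> :: (nat \<Rightarrow>\<^sub>C 'a) set)"
  have "\<U> \<noteq> bot"
    using \<U> by (simp add: free_ultrafilter_def)
  obtain C where C: "\<And>v. v \<in> A \<Longrightarrow> norm v \<le> C"
    using \<open>bounded A\<close> by (auto simp: bounded_iff)
  have "\<exists>x. x ` {..<n} \<subseteq> A \<and> ladder x n \<theta>" for n
    using contra by blast
  then obtain X where X: "\<And>n. X n ` {..<n} \<subseteq> A" and "\<And>n. ladder (X n) n \<theta>"
    by metis
  then have "\<exists>f :: nat \<Rightarrow> 'a \<Rightarrow>\<^sub>L real. (\<forall>i. norm (f i) \<le> 1) \<and>
     (\<forall>i j j'. j < i \<longrightarrow> i \<le> j' \<longrightarrow> j' < n \<longrightarrow>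
        \<theta> \<le> blinfun_apply (f i) (X n j) - blinfun_apply (f i) (X n j'))" for n
    unfolding ladder_def by blast
  then obtain f :: "nat \<Rightarrow> nat \<Rightarrow> 'a \<Rightarrow>\<^sub>L real" where f: "\<And>n i. norm (f n i) \<le> 1"
    and fX: "\<And>n i j j'. j < i \<Longrightarrow> i \<le> j' \<Longrightarrow> j' < n \<Longrightarrow>
      \<theta> \<le> blinfun_apply (f n i) (X n j) - blinfun_apply (f n i) (X n j')"
    by metis
  have XA: "X n j \<in> A" if "j < n" for n j
    using X[of n] that by blast
  \<comment> \<open>Coordinate \<open>n\<close> of the \<open>j\<close>-th element comes from the
    ladder of length \<open>n\<close>, which controls it only for \<open>j < n\<close>. Elsewhere
    the member \<open>X 1 0\<close> of \<open>A\<close> fills in; a free ultrafilter ignores these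
    finitely many coordinates.\<close>
  define z where "z j = Bcontfun (\<lambda>n. if j < n then X n j else X 1 0)" for j
  have zA: "(if j < n then X n j else X 1 0) \<in> A" for n j
    using XA[of j n] XA[of 0 1] by simp
  have z: "apply_bcontfun (z j) n = (if j < n then X n j else X 1 0)" for j n
  proof -
    have "(\<lambda>n. if j < n then X n j else X 1 0) \<in> bcontfun"
      using C[OF zA[of j]] by (intro bcontfun_normI[of _ C]) simp_all
    then show ?thesis
      unfolding z_def by (subst Bcontfun_inverse) simp_all
  qed
  have "coset Z (z j) \<in> quotient_weak_topology Z closure_of ultrapower_set \<U> A" for j
  proof -
    have "coset Z (z j) \<in> ultrapower_set \<U> A"
      using zA z unfolding ultrapower_set_def Z_def by auto
    moreover have "ultrapower_set \<U> A \<subseteq> topspace (quotient_weak_topology Z)"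
      by (auto simp: ultrapower_set_def Z_def quotient_space_def)
    ultimately show ?thesis
      using closure_of_subset by blast
  qed
  then obtain w where w: "\<And>\<phi> \<delta>. \<phi> \<in> quotient_dual Z \<Longrightarrow> 0 < \<delta> \<Longrightarrow>
    infinite {j. \<bar>\<phi> (coset Z (z j)) - \<phi> (coset Z w)\<bar> < \<delta>}"
    using quotient_weak_cluster_point[OF K[folded Z_def], of z] by blast
  have lim_cong: "Lim \<U> a = L" if "(a \<longlongrightarrow> L) \<U>" for a and L :: real
    using that \<open>\<U> \<noteq> bot\<close> by (intro tendsto_Lim)
  \<comment> \<open>\<open>\<Lambda> i\<close> is the ultraproduct of the functionals at step
    \<open>i\<close> of the ladders.\<close>
  define \<Lambda> where "\<Lambda> i v = Lim \<U> (\<lambda>n. blinfun_apply (f n i) (apply_bcontfun v n))"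
    for i and v :: "nat \<Rightarrow>\<^sub>C 'a"
  have fb: "\<bar>blinfun_apply (f n i) (apply_bcontfun v n)\<bar> \<le> norm v" for n i and v :: "nat \<Rightarrow>\<^sub>C 'a"
    using abs_blinfun_apply_le[OF f] norm_bounded by (rule order_trans)
  have \<Lambda>: "((\<lambda>n. blinfun_apply (f n i) (apply_bcontfun v n)) \<longlongrightarrow> \<Lambda> i v) \<U>" for i v
    unfolding \<Lambda>_def using fb by (rule free_ultrafilter_convergent[OF \<U>])
  have \<Lambda>_add: "\<Lambda> i (u + v) = \<Lambda> i u + \<Lambda> i v" for i u v
    unfolding \<Lambda>_def[of i "u + v"] using tendsto_add[OF \<Lambda> \<Lambda>, of i u i v]
    by (intro lim_cong) (simp add: blinfun.add_right)
  have \<Lambda>_scale: "\<Lambda> i (c *\<^sub>R v) = c * \<Lambda> i v" for i c v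
    unfolding \<Lambda>_def[of i "c *\<^sub>R v"] using tendsto_mult[OF tendsto_const \<Lambda>, of c i v]
    by (intro lim_cong) (simp add: blinfun.scaleR_right)
  have \<Lambda>_bound: "\<bar>\<Lambda> i v\<bar> \<le> norm v" for i v
    by (rule tendsto_upperbound[OF tendsto_rabs[OF \<Lambda>] always_eventually[OF allI[OF fb]] \<open>\<U> \<noteq> bot\<close>])
  have \<Lambda>_null: "\<Lambda> i v = 0" if "v \<in> Z" for i v
  proof -
    have "((\<lambda>n. norm (apply_bcontfun v n)) \<longlongrightarrow> 0) \<U>"
      using that by (simp add: Z_def ultra_null_sequences_def)
    moreover have "\<forall>n. norm (blinfun_apply (f n i) (apply_bcontfun v n)) \<le> norm (apply_bcontfun v n)"
      using abs_blinfun_apply_le[OF f] by simp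
    ultimately have "((\<lambda>n. blinfun_apply (f n i) (apply_bcontfun v n)) \<longlongrightarrow> 0) \<U>"
      by (rule Lim_null_comparison[OF always_eventually, rotated])
    then show ?thesis
      unfolding \<Lambda>_def by (rule lim_cong)
  qed
  \<comment> \<open>The same ultrafilter is used again for the outer limit, so
    \<open>\<Lambda>'\<close> is a pointwise limit of the \<open>\<Lambda> i\<close>.\<close>
  define \<Lambda>' where "\<Lambda>' v = Lim \<U> (\<lambda>i. \<Lambda> i v)" for v
  have \<Lambda>': "((\<lambda>i. \<Lambda> i v) \<longlongrightarrow> \<Lambda>' v) \<U>" for v
    unfolding \<Lambda>'_def using \<Lambda>_bound by (rule free_ultrafilter_convergent[OF \<U>])
  have "0 \<in> Z"
    by (simp add: Z_def ultra_null_sequences_def)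
  have large: "eventually (\<lambda>n. m < n) \<U>" for m
  proof -
    have "eventually (\<lambda>n. \<forall>m'\<in>{..m}. n \<noteq> m') \<U>"
      using \<U> unfolding free_ultrafilter_def by (intro eventually_ball_finite) auto
    then show ?thesis
      by (rule eventually_mono) force
  qed
  have drop: "\<theta> \<le> \<Lambda> i (z j) - \<Lambda> i (z j')" if "j < i" "i \<le> j'" for i j j'
  proof (rule tendsto_lowerbound)
    show "((\<lambda>n. blinfun_apply (f n i) (apply_bcontfun (z j) n) - blinfun_apply (f n i) (apply_bcontfun (z j') n))
      \<longlongrightarrow> \<Lambda> i (z j) - \<Lambda> i (z j')) \<U>"
      by (intro tendsto_diff \<Lambda>)
    show "eventually (\<lambda>n. \<theta> \<le> blinfun_apply (f n i) (apply_bcontfun (z j) n) -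
        blinfun_apply (f n i) (apply_bcontfun (z j') n)) \<U>"
      using large[of j']
    proof (rule eventually_mono)
      fix n assume "j' < n"
      then show "\<theta> \<le> blinfun_apply (f n i) (apply_bcontfun (z j) n) -
        blinfun_apply (f n i) (apply_bcontfun (z j') n)"
        using fX[OF that, of n] that by (simp add: z)
    qed
  qed (fact \<open>\<U> \<noteq> bot\<close>)
  text \<open>The double limit argument: pass to the limit first in \<open>j'\<close>, then in \<open>i\<close>.\<close>
  have drop': "\<theta> \<le> \<Lambda> i (z j) - \<Lambda> i w" if "j < i" for i j
  proof (rule ccontr)
    assume "\<not> \<theta> \<le> \<Lambda> i (z j) - \<Lambda> i w"
    then have pos: "0 < \<theta> - (\<Lambda> i (z j) - \<Lambda> i w)"
      by simp
    obtain \<phi> where "\<phi> \<in> quotient_dual Z" and \<phi>: "\<And>v. \<phi> (coset Z v) = \<Lambda> i v"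
      using \<Lambda>_add \<Lambda>_scale \<Lambda>_bound \<open>0 \<in> Z\<close> \<Lambda>_null by (rule quotient_dual_lift[of "\<Lambda> i"]) (assumption, rule that)
    from w[OF this(1) pos] obtain j' where "i \<le> j'"
      and "\<bar>\<Lambda> i (z j') - \<Lambda> i w\<bar> < \<theta> - (\<Lambda> i (z j) - \<Lambda> i w)"
      unfolding \<phi> infinite_nat_iff_unbounded_le by blast
    then show False
      using drop[OF that, of j'] by linarith
  qed
  have drop'': "\<theta> \<le> \<Lambda>' (z j) - \<Lambda>' w" for j
  proof (rule tendsto_lowerbound)
    show "((\<lambda>i. \<Lambda> i (z j) - \<Lambda> i w) \<longlongrightarrow> \<Lambda>' (z j) - \<Lambda>' w) \<U>"
      by (intro tendsto_diff \<Lambda>')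
    show "eventually (\<lambda>i. \<theta> \<le> \<Lambda> i (z j) - \<Lambda> i w) \<U>"
      using large[of j] by (rule eventually_mono) (rule drop')
  qed (fact \<open>\<U> \<noteq> bot\<close>)
  have add': "\<Lambda>' (u + v) = \<Lambda>' u + \<Lambda>' v" for u v
    unfolding \<Lambda>'_def[of "u + v"] using tendsto_add[OF \<Lambda>' \<Lambda>', of u v]
    by (intro lim_cong) (simp add: \<Lambda>_add)
  have scale': "\<Lambda>' (c *\<^sub>R v) = c * \<Lambda>' v" for c v
    unfolding \<Lambda>'_def[of "c *\<^sub>R v"] using tendsto_mult[OF tendsto_const \<Lambda>', of c v]
    by (intro lim_cong) (simp add: \<Lambda>_scale)
  have bound': "\<bar>\<Lambda>' v\<bar> \<le> norm v" for v
    by (rule tendsto_upperbound[OF tendsto_rabs[OF \<Lambda>'] always_eventually[OF allI[OF \<Lambda>_bound]] \<open>\<U> \<noteq> bot\<close>])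
  have null': "\<Lambda>' v = 0" if "v \<in> Z" for v
    unfolding \<Lambda>'_def using \<Lambda>_null[OF that] by (intro lim_cong) simp
  obtain \<phi> where "\<phi> \<in> quotient_dual Z" and \<phi>: "\<And>v. \<phi> (coset Z v) = \<Lambda>' v"
    using add' scale' bound' \<open>0 \<in> Z\<close> null' by (rule quotient_dual_lift[of "\<Lambda>'"]) (assumption, rule that)
  from w[OF this(1) \<open>0 < \<theta>\<close>] obtain j where "\<bar>\<Lambda>' (z j) - \<Lambda>' w\<bar> < \<theta>"
    unfolding \<phi> using not_finite_existsD by blast
  with drop''[of j] show False
    by linarith
qed

section \<open>The counterexample built from summing bases\<close>

section \<open>Staircases in the space of bounded sequences\<close>

text \<open>Coordinates are pairs \<open>(N, i)\<close>; \<open>staircase N j\<close> is the indicator of \<open>{(N, i) | i. i \<le> j}\<close>.\<close>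
definition staircase :: "nat \<Rightarrow> nat \<Rightarrow> (nat \<Rightarrow>\<^sub>C real)" where
  "staircase N j = Bcontfun (\<lambda>m. if fst (prod_decode m) = N \<and> snd (prod_decode m) \<le> j then 1 else 0)"

lemma staircase_apply:
  "apply_bcontfun (staircase N j) m = (if fst (prod_decode m) = N \<and> snd (prod_decode m) \<le> j then 1 else 0)"
proof -
  have "(\<lambda>m. if fst (prod_decode m) = N \<and> snd (prod_decode m) \<le> j then 1 else 0 :: real) \<in> bcontfun"
    by (intro bcontfun_normI[of _ 1]) simp_all
  then show ?thesis
    unfolding staircase_def by (subst Bcontfun_inverse) simp_all
qed

lemma norm_staircase_le: "norm (staircase N j) \<le> 1"
  by (rule norm_bound) (simp add: staircase_apply)

text \<open>The coordinate \<open>(N, i)\<close> of \<open>staircase N j\<close> is 0 for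
  \<open>j < i\<close> and 1 for \<open>j \<ge> i\<close>; its negative is the functional at step
  \<open>i\<close>.\<close>

lemma ladder_staircase: "ladder (staircase N) N 1"
proof -
  have abs_le: "\<bar>apply_bcontfun v m\<bar> \<le> norm v" for v :: "nat \<Rightarrow>\<^sub>C real" and m
    using norm_bounded[of v m] by simp
  have bl: "bounded_linear (\<lambda>v :: nat \<Rightarrow>\<^sub>C real. - apply_bcontfun v m)" for m
    by (intro bounded_linear_intro[of _ 1]) (simp_all add: abs_le)
  define f where "f i = Blinfun (\<lambda>v :: nat \<Rightarrow>\<^sub>C real. - apply_bcontfun v (prod_encode (N, i)))" for i
  have f: "blinfun_apply (f i) v = - apply_bcontfun v (prod_encode (N, i))" for i v
    by (simp add: f_def bounded_linear_Blinfun_apply[OF bl])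
  have "norm (f i) \<le> 1" for i
    by (intro norm_blinfun_bound) (simp_all add: f abs_le)
  then show ?thesis
    unfolding ladder_def by (intro exI[of _ f]) (simp add: f staircase_apply)
qed

lemma apply_bcontfun_sum:
  "apply_bcontfun (\<Sum>n\<in>F. g n) m = (\<Sum>n\<in>F. apply_bcontfun (g n) m)"
  for g :: "'b \<Rightarrow> 'c::topological_space \<Rightarrow>\<^sub>C 'd::real_normed_vector"
  by (induction F rule: infinite_finite_induct) simp_all

text \<open>Distinct blocks have disjoint supports, so signed finite sums have supremum norm at most
  1. Hence the absolute values of a functional of norm at most 1 sum to at most 1, and at most
  \<open>1 / \<epsilon>\<close> of them exceed \<open>\<epsilon>\<close>.\<close>

lemma uniformly_weakly_null_staircase:
  assumes "inj N"
  shows "uniformly_weakly_null_set (range (\<lambda>n. staircase (N n) (j n)))"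
  unfolding uniformly_weakly_null_set_def
proof (intro allI impI)
  fix \<epsilon> :: real assume "0 < \<epsilon>"
  define y where "y n = staircase (N n) (j n)" for n
  define k where "k = nat \<lceil>1 / \<epsilon>\<rceil>"
  have le_k: "card T \<le> k"
    if f: "norm f \<le> 1" and T: "finite T" "\<And>n. n \<in> T \<Longrightarrow> \<epsilon> < \<bar>blinfun_apply f (y n)\<bar>"
    for f :: "(nat \<Rightarrow>\<^sub>C real) \<Rightarrow>\<^sub>L real" and T
  proof -
    define v where "v = (\<Sum>n\<in>T. sgn (blinfun_apply f (y n)) *\<^sub>R y n)"
    have "norm v \<le> 1"
    proof (rule norm_bound)
      fix m
      have "norm (apply_bcontfun v m) \<le> (\<Sum>n\<in>T. \<bar>sgn (blinfun_apply f (y n)) * apply_bcontfun (y n) m\<bar>)"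
        unfolding v_def apply_bcontfun_sum by simp
      also have "\<dots> \<le> (\<Sum>n\<in>T. if fst (prod_decode m) = N n then 1 else 0)"
        by (intro sum_mono) (auto simp: y_def staircase_apply abs_mult sgn_if)
      also have "\<dots> = real (card {n \<in> T. fst (prod_decode m) = N n})"
        using T(1) by (simp flip: sum.inter_filter)
      also have "card {n \<in> T. fst (prod_decode m) = N n} \<le> 1"
        using injD[OF \<open>inj N\<close>] by (auto simp: card_le_Suc0_iff_eq T(1))
      finally show "norm (apply_bcontfun v m) \<le> 1"
        by simp
    qed
    have "real (card T) * \<epsilon> \<le> (\<Sum>n\<in>T. \<bar>blinfun_apply f (y n)\<bar>)"
      using T(2) by (intro sum_bounded_below less_imp_le)
    also have "\<dots> = blinfun_apply f v"
      by (simp add: v_def blinfun.sum_right blinfun.scaleR_right mult_sgn_abs abs_sgn mult.commute)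
    also have "\<dots> \<le> 1"
      using abs_blinfun_apply_le[OF f, of v] \<open>norm v \<le> 1\<close> by linarith
    finally have "real (card T) \<le> 1 / \<epsilon>"
      using \<open>0 < \<epsilon>\<close> by (simp add: field_simps)
    then show ?thesis
      unfolding k_def by linarith
  qed
  have "finite {x \<in> range y. \<bar>blinfun_apply f x\<bar> > \<epsilon>} \<and> card {x \<in> range y. \<bar>blinfun_apply f x\<bar> > \<epsilon>} \<le> k"
    if f: "norm f \<le> 1" for f :: "(nat \<Rightarrow>\<^sub>C real) \<Rightarrow>\<^sub>L real"
  proof -
    define I where "I = {n. \<epsilon> < \<bar>blinfun_apply f (y n)\<bar>}"
    have le_k': "card T \<le> k" if "finite T" "T \<subseteq> I" for T
      using le_k[OF f that(1)] that(2) unfolding I_def by blast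
    have "finite I"
    proof (rule ccontr)
      assume "infinite I"
      then obtain T where "finite T" "card T = Suc k" "T \<subseteq> I"
        using infinite_arbitrarily_large by blast
      then show False
        using le_k'[of T] by simp
    qed
    have eq: "{x \<in> range y. \<bar>blinfun_apply f x\<bar> > \<epsilon>} = y ` I"
      by (auto simp: I_def)
    show ?thesis
      unfolding eq using card_image_le[OF \<open>finite I\<close>, of y] le_k'[OF \<open>finite I\<close>] \<open>finite I\<close> by simp
  qed
  then show "\<exists>k. \<forall>f :: (nat \<Rightarrow>\<^sub>C real) \<Rightarrow>\<^sub>L real. norm f \<le> 1 \<longrightarrow>
      finite {x \<in> range (\<lambda>n. staircase (N n) (j n)). \<bar>blinfun_apply f x\<bar> > \<epsilon>} \<and>
      card {x \<in> range (\<lambda>n. staircase (N n) (j n)). \<bar>blinfun_apply f x\<bar> > \<epsilon>} \<le> k"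
    unfolding y_def by blast
qed

lemma uniformly_weakly_null_set_finite:
  assumes "finite A"
  shows "uniformly_weakly_null_set A"
  unfolding uniformly_weakly_null_set_def
proof (intro allI impI exI conjI)
  fix \<epsilon> :: real and f :: "'a \<Rightarrow>\<^sub>L real"
  show "finite {x \<in> A. \<bar>blinfun_apply f x\<bar> > \<epsilon>}" "card {x \<in> A. \<bar>blinfun_apply f x\<bar> > \<epsilon>} \<le> card A"
    using assms by (auto intro: card_mono)
qed

lemma uniformly_weakly_convergent_subseq_staircase:
  fixes x :: "nat \<Rightarrow> (nat \<Rightarrow>\<^sub>C real)"
  assumes x: "range x \<subseteq> {staircase N j | N j. j < N}"
  shows "\<exists>r. strict_mono r \<and> uniformly_weakly_convergent (x \<circ> r)"
proof -
  have "\<exists>N j. x n = staircase N j \<and> j < N" for n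
    using x by blast
  then obtain N j where Nj: "\<And>n. x n = staircase (N n) (j n)" "\<And>n. j n < N n"
    by metis
  have "\<exists>r. strict_mono r \<and> uniformly_weakly_null (x \<circ> r)"
  proof (cases "finite (range x)")
    case True
    then have "uniformly_weakly_null (x \<circ> id)"
      unfolding uniformly_weakly_null_def by (simp add: uniformly_weakly_null_set_finite)
    then show ?thesis
      using strict_mono_id by blast
  next
    case False
    \<comment> \<open>Because of \<open>j < N\<close>, bounded block numbers leave only finitely
      many staircases, so an infinite range must reach ever higher blocks.\<close>
    have next_block: "\<exists>n. m < n \<and> N m < N n" for m
    proof (rule ccontr)
      assume "\<not> ?thesis"
      then have "N n \<le> N m" if "m < n" for n
        using that not_le by blast
      then have "x n \<in> (\<lambda>(a, b). staircase a b) ` ({..N m} \<times> {..N m})" if "m < n" for n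
        using that Nj(2)[of n] unfolding Nj(1)[of n] by (intro image_eqI[of _ _ "(N n, j n)"]) fastforce+
      then have "range x \<subseteq> x ` {..m} \<union> (\<lambda>(a, b). staircase a b) ` ({..N m} \<times> {..N m})"
        by (auto simp: not_le[symmetric])
      then show False
        using False finite_subset by blast
    qed
    then obtain r where r: "\<And>n :: nat. r n < r (Suc n) \<and> N (r n) < N (r (Suc n))"
      using dependent_nat_choice[of "\<lambda>_ _. True" "\<lambda>_ m n. m < n \<and> N m < N n"] by blast
    then have "strict_mono r" "strict_mono (\<lambda>n. N (r n))"
      by (simp_all add: strict_mono_Suc_iff)
    then have "uniformly_weakly_null (x \<circ> r)"
      unfolding uniformly_weakly_null_def o_def Nj(1)
      by (intro uniformly_weakly_null_staircase strict_mono_imp_inj_on)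
    with \<open>strict_mono r\<close> show ?thesis
      by blast
  qed
  then obtain r :: "nat \<Rightarrow> nat" where "strict_mono r" "uniformly_weakly_null (\<lambda>n. (x \<circ> r) n - 0)"
    by (auto simp: o_def)
  then show ?thesis
    unfolding uniformly_weakly_convergent_def by blast
qed

theorem corollary2p6:
  fixes A :: "'a::banach set"
  shows
    "(relatively_super_weakly_compact A \<longrightarrow>
        (\<forall>x :: nat \<Rightarrow> 'a. range x \<subseteq> A \<longrightarrow>
           (\<exists>r. strict_mono r \<and> uniformly_weakly_convergent (x \<circ> r))))
     \<and>
     (\<exists>B :: (nat \<Rightarrow>\<^sub>C real) set.
        bounded B \<and>
        (\<forall>x :: nat \<Rightarrow> (nat \<Rightarrow>\<^sub>C real). range x \<subseteq> B \<longrightarrow>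
           (\<exists>r. strict_mono r \<and> uniformly_weakly_convergent (x \<circ> r))) \<and>
        \<not> relatively_super_weakly_compact B)
     \<and>
     ((\<forall>x :: nat \<Rightarrow> 'a. range x \<subseteq> A \<longrightarrow>
           (\<exists>r. strict_mono r \<and> uniformly_weakly_convergent (x \<circ> r)))
        \<longleftrightarrow> Banach_Saks_set A)"
proof (intro conjI iffI allI impI)
  fix x :: "nat \<Rightarrow> 'a"
  assume A: "relatively_super_weakly_compact A" and x: "range x \<subseteq> A"
  have "bounded A"
    using A by (simp add: relatively_super_weakly_compact_def)
  then have "Banach_Saks_set A"
    using no_long_ladders_if_relatively_super_weakly_compact[OF A] by (rule Banach_Saks_set_if_no_ladders)
  then show "\<exists>r. strict_mono r \<and> uniformly_weakly_convergent (x \<circ> r)"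
    using x by (rule uniformly_weakly_convergent_subseq_if_Banach_Saks)
next
  \<comment> \<open>Every block is finite, yet the block \<open>N\<close> contains a ladder of
    length \<open>N\<close> with gap 1.\<close>
  define B where "B = {staircase N j | N j. j < N}"
  have "bounded B"
    unfolding B_def bounded_iff using norm_staircase_le by blast
  moreover have "\<not> relatively_super_weakly_compact B"
  proof
    assume "relatively_super_weakly_compact B"
    from no_long_ladders_if_relatively_super_weakly_compact[OF this zero_less_one]
    obtain N where "\<And>x. x ` {..<N} \<subseteq> B \<Longrightarrow> \<not> ladder x N 1"
      by blast
    moreover have "staircase N ` {..<N} \<subseteq> B"
      by (auto simp: B_def)
    ultimately show False
      using ladder_staircase by blast
  qed
  ultimately show "\<exists>B :: (nat \<Rightarrow>\<^sub>C real) set.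
        bounded B \<and>
        (\<forall>x :: nat \<Rightarrow> (nat \<Rightarrow>\<^sub>C real). range x \<subseteq> B \<longrightarrow>
           (\<exists>r. strict_mono r \<and> uniformly_weakly_convergent (x \<circ> r))) \<and>
        \<not> relatively_super_weakly_compact B"
    using uniformly_weakly_convergent_subseq_staircase unfolding B_def by blast
next
  assume "\<forall>x :: nat \<Rightarrow> 'a. range x \<subseteq> A \<longrightarrow> (\<exists>r. strict_mono r \<and> uniformly_weakly_convergent (x \<circ> r))"
  then show "Banach_Saks_set A"
    by (intro Banach_Saks_if_uniformly_weakly_convergent) blast
next
  fix x :: "nat \<Rightarrow> 'a" assume "Banach_Saks_set A" "range x \<subseteq> A"
  then show "\<exists>r. strict_mono r \<and> uniformly_weakly_convergent (x \<circ> r)"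
    by (rule uniformly_weakly_convergent_subseq_if_Banach_Saks)
qed

end
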